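(* Let $\delta \in \{1,2\}$ and $q = p^n$, where $p$ is a prime number and $n\ge 2$ is an integer. Let $f$ be a bivariate permutation group polynomial over $\mathbb{F}_q$ whose associated group is the group $G=\langle a_0,\ldots,a_{n-\delta}\rangle<\mathfrak{S}_q$ defined in the context. Let $\mathcal{P}_{f}$ denote the number of all bivariate permutation group polynomials over $\mathbb{F}_q$ that are of the form $f$, i.e. whose associated group is isomorphic to $G$. Then $$\mathcal{P}_{f} = \dfrac{(p^n)!\,(p^n-1)!}{\left(p^{n}-p^{(\delta-1)(n-\delta+1)}\right)\displaystyle\prod_{i=1}^{n-\delta}\left(p^{n-\delta+1}-p^{i}\right)}.$$
   Context: Let $\mathbb{F}_q = \{c_0, \ldots, c_{q-1}\}$ be a fixed listing, and let $\mathfrak{S}_q$ be the symmetric group on the set $\mathbb{F}_q$ (products are compositions). Polynomials over $\mathbb{F}_q$ are taken with degree less than $q$ in each variable, i.e. identified with functions. A polynomial $f\in\mathbb{F}_q[X_1,X_2]$ is a local permutation polynomial (LPP) if $f(a,X_2)$ and $f(X_1,a)$ are permutation polynomials of $\mathbb{F}_q$ for every $a\in\mathbb{F}_q$. LPPs correspond bijectively to permutation polynomial tuples, i.e. (ordered) tuples $\underline{\beta}_f=(\beta_0,\ldots,\beta_{q-1})\in\mathfrak{S}_q^q$ such that $\beta_i\beta_j^{-1}$ has no fixed points for $i\ne j$, via $f(x,\beta_i(x))=c_i$ for all $x\in\mathbb{F}_q$ and all $i$. If $\{\beta_0,\ldots,\beta_{q-1}\}$ is a subgroup of $\mathfrak{S}_q$,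 then $f$ is called a permutation group polynomial and this subgroup is its associated group. Two permutation group polynomials are of the same form if their associated groups are isomorphic. For $\delta\in\{1,2\}$, the group $G$ is generated by $a_0 := \prod_{j=0}^{p^{n-\delta}-1} (c_{jp^{\delta}}, c_{jp^{\delta}+1}, \ldots, c_{jp^{\delta}+p^{\delta}-1})$ and, for $1\le i\le n-\delta$, $a_i := \prod_{j} (c_{j}, c_{j+p^{i+\delta-1}}, \ldots, c_{j+(p-1)p^{i+\delta-1}})$, where the product is over all $0\le j\le q-1$ with $(j \bmod p^{i+\delta}) < p^{i+\delta-1}$. It is an Abelian group of order $q$, isomorphic to $\mathbb{Z}_{p^\delta}\times\mathbb{Z}_p^{n-\delta}$, in which no non-identity element has a fixed point. Empty products equal $1$. *)

theory Defs
  imports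
    "HOL-Algebra.Bij"
    "HOL-Algebra.Generated_Groups"
    "HOL-Combinatorics.Cycles"
    "HOL-Computational_Algebra.Polynomial"
    "HOL-Computational_Algebra.Primes"
    "HOL-Library.Cardinality"
begin

text \<open>
  A bivariate polynomial in \<open>X\<^sub>1, X\<^sub>2\<close> over a finite field is an element of \<^typ>\<open>'a poly poly\<close>: the
  outer variable is \<open>X\<^sub>2\<close>, and the coefficients are polynomials in \<open>X\<^sub>1\<close>.
\<close>

definition reduced_poly2 :: "'a::{finite,field} poly poly \<Rightarrow> bool" where
  "reduced_poly2 f \<longleftrightarrow> degree f < CARD('a) \<and> (\<forall>k. degree (coeff f k) < CARD('a))"

definition subst_fst :: "'a::field poly poly \<Rightarrow> 'a \<Rightarrow> 'a poly" where  \<comment> \<open>\<open>f(a, X\<^sub>2)\<close>\<close>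
  "subst_fst f a = map_poly (\<lambda>u. poly u a) f"

definition subst_snd :: "'a::field poly poly \<Rightarrow> 'a \<Rightarrow> 'a poly" where  \<comment> \<open>\<open>f(X\<^sub>1, a)\<close>\<close>
  "subst_snd f a = poly f [:a:]"

definition eval2 :: "'a::field poly poly \<Rightarrow> 'a \<Rightarrow> 'a \<Rightarrow> 'a" where  \<comment> \<open>\<open>f(x, y)\<close>\<close>
  "eval2 f x y = poly (subst_fst f x) y"

definition perm_poly :: "'a::{finite,field} poly \<Rightarrow> bool" where
  "perm_poly g \<longleftrightarrow> bij (poly g)"

definition local_perm_poly :: "'a::{finite,field} poly poly \<Rightarrow> bool" where
  "local_perm_poly f \<longleftrightarrow>
     reduced_poly2 f \<and> (\<forall>a. perm_poly (subst_fst f a) \<and> perm_poly (subst_snd f a))"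

text \<open>
  The tuple \<open>(\<beta>\<^sub>0, \<dots>, \<beta>\<^bsub>q-1\<^esub>)\<close> of \<open>f\<close> with respect to the listing \<open>c\<close> of the field; for a local
  permutation polynomial the description below is well defined, see \<open>eval2_beta\<close> and
  \<open>beta_unique\<close>.
\<close>

definition beta :: "(nat \<Rightarrow> 'a) \<Rightarrow> 'a::{finite,field} poly poly \<Rightarrow> nat \<Rightarrow> 'a \<Rightarrow> 'a" where
  "beta c f i = (\<lambda>x. THE y. eval2 f x y = c i)"

lemma beta_ex1:
  assumes "local_perm_poly f"
  shows "\<exists>!y. eval2 f x y = c i"
  using assms unfolding local_perm_poly_def perm_poly_def eval2_def bij_iff by blast

lemma eval2_beta: "local_perm_poly f \<Longrightarrow> eval2 f x (beta c f i x) = c i"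
  unfolding beta_def by (rule theI'[OF beta_ex1])

lemma beta_unique: "local_perm_poly f \<Longrightarrow> eval2 f x y = c i \<Longrightarrow> beta c f i x = y"
  using beta_ex1 eval2_beta by metis

lemma poly_subst_snd: "poly (subst_snd f y) x = eval2 f x y"
  unfolding subst_snd_def eval2_def subst_fst_def
  by (induction f) (auto simp: map_poly_pCons)

abbreviation sym_grp :: "('a \<Rightarrow> 'a) monoid" where
  "sym_grp \<equiv> BijGroup (UNIV :: 'a set)"

definition assoc_set :: "(nat \<Rightarrow> 'a) \<Rightarrow> 'a::{finite,field} poly poly \<Rightarrow> ('a \<Rightarrow> 'a) set" where
  "assoc_set c f = beta c f ` {..<CARD('a)}"

definition perm_group_poly :: "(nat \<Rightarrow> 'a) \<Rightarrow> 'a::{finite,field} poly poly \<Rightarrow> bool" where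
  "perm_group_poly c f \<longleftrightarrow> local_perm_poly f \<and> subgroup (assoc_set c f) sym_grp"

definition same_form :: "(nat \<Rightarrow> 'a) \<Rightarrow> 'a::{finite,field} poly poly \<Rightarrow> 'a poly poly \<Rightarrow> bool" where
  "same_form c f g \<longleftrightarrow>
     sym_grp\<lparr>carrier := assoc_set c f\<rparr> \<cong> sym_grp\<lparr>carrier := assoc_set c g\<rparr>"

definition num_same_form :: "(nat \<Rightarrow> 'a) \<Rightarrow> 'a::{finite,field} poly poly \<Rightarrow> nat" where
  "num_same_form c f = card {g. perm_group_poly c g \<and> same_form c g f}"

definition comp_list :: "('a \<Rightarrow> 'a) list \<Rightarrow> 'a \<Rightarrow> 'a" where
  "comp_list gs = foldr (\<circ>) gs id"

text \<open>
  The generators \<open>a\<^sub>0\<close> and \<open>a\<^sub>i\<close> (\<open>1 \<le> i \<le> n - \<delta>\<close>). Within each product the cycles are disjoint, so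
  the order in which they are composed is immaterial.
\<close>

definition gen :: "nat \<Rightarrow> nat \<Rightarrow> nat \<Rightarrow> (nat \<Rightarrow> 'a) \<Rightarrow> nat \<Rightarrow> 'a \<Rightarrow> 'a" where
  "gen p n \<delta> c i =
     (if i = 0
      then comp_list
             [cycle_of_list [c (j * p ^ \<delta> + k). k \<leftarrow> [0..<p ^ \<delta>]].
                j \<leftarrow> [0..<p ^ (n - \<delta>)]]
      else comp_list
             [cycle_of_list [c (j + k * p ^ (i + \<delta> - 1)). k \<leftarrow> [0..<p]].
                j \<leftarrow> [0..<p ^ n], j mod p ^ (i + \<delta>) < p ^ (i + \<delta> - 1)])"

definition G_set :: "nat \<Rightarrow> nat \<Rightarrow> nat \<Rightarrow> (nat \<Rightarrow> 'a) \<Rightarrow> ('a \<Rightarrow> 'a) set" where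
  "G_set p n \<delta> c = generate sym_grp (gen p n \<delta> c ` {0..n - \<delta>})"

end

theory Submission
  imports Defs "HOL-Algebra.FiniteProduct"
begin

text \<open>
  A permutation group polynomial is an ordering of a simply transitive subgroup of the symmetric
  group, so each such subgroup accounts for \<open>q!\<close> polynomials and one has to count the simply
  transitive subgroups \<open>H \<cong> G\<close>. Embeddings of \<open>G\<close> with simply transitive image, taken together with
  a base point, correspond to bijections from \<open>G\<close> to the field, so there are \<open>(q - 1)!\<close> of them. Each
  image \<open>H\<close> arises from as many embeddings as there are isomorphisms \<open>G \<rightarrow> H\<close>, and an isomorphism is
  determined by the images of the generators \<open>a\<^sub>0, \<dots>, a\<^bsub>n-\<delta>\<^esub>\<close>, which may be any independent tuple of
  elements of orders \<open>p\<^sup>\<delta>, p, \<dots>, p\<close>. Such tuples are counted by extending them one element at a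
  time: after \<open>k \<ge> 1\<close> steps the \<open>p\<close>-torsion of the span has \<open>p\<^sup>k\<close> elements, and these are exactly the
  ones excluded among the \<open>p\<^bsup>n-\<delta>+1\<^esup>\<close> elements of the \<open>p\<close>-torsion of \<open>H\<close>. The generators themselves
  are independent because they act by rotating different digits of the index, whence they commute,
  and because \<open>G\<close> has order \<open>p\<^sup>n\<close>.
\<close>

section \<open>Independent tuples in finite commutative groups\<close>

text \<open>Integer exponents give room for inverses, for differences of exponent vectors and for
  Bezout coefficients.\<close>

definition power_prod :: "('g, 'm) monoid_scheme \<Rightarrow> nat \<Rightarrow> (nat \<Rightarrow> 'g) \<Rightarrow> (nat \<Rightarrow> int) \<Rightarrow> 'g" where
  "power_prod G k b e = finprod G (\<lambda>i. b i [^]\<^bsub>G\<^esub> e i) {..<k}"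

text \<open>For positive \<open>r\<close> this says that the span of \<open>b\<close> is the
  internal direct product of the cyclic groups generated by the \<open>b i\<close>, and that
  \<open>b i\<close> has order exactly \<open>r i\<close>.\<close>

definition indep :: "('g, 'm) monoid_scheme \<Rightarrow> (nat \<Rightarrow> nat) \<Rightarrow> nat \<Rightarrow> (nat \<Rightarrow> 'g) \<Rightarrow> bool" where
  "indep G r k b \<longleftrightarrow>
     (\<forall>i<k. b i \<in> carrier G \<and> b i [^]\<^bsub>G\<^esub> r i = \<one>\<^bsub>G\<^esub>) \<and>
     (\<forall>e. power_prod G k b e = \<one>\<^bsub>G\<^esub> \<longrightarrow> (\<forall>i<k. int (r i) dvd e i))"

text \<open>Extensional functions make each tuple of length \<open>k\<close> a single function, so
  that tuples can be counted.\<close>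

definition indep_tuples :: "('g, 'm) monoid_scheme \<Rightarrow> (nat \<Rightarrow> nat) \<Rightarrow> nat \<Rightarrow> (nat \<Rightarrow> 'g) set" where
  "indep_tuples G r k = {b \<in> {..<k} \<rightarrow>\<^sub>E carrier G. indep G r k b}"

text \<open>Representatives of the exponent vectors modulo the \<open>r i\<close>.\<close>

definition exponent_box :: "(nat \<Rightarrow> nat) \<Rightarrow> nat \<Rightarrow> (nat \<Rightarrow> int) set" where
  "exponent_box r k = (\<Pi>\<^sub>E i\<in>{..<k}. {0..<int (r i)})"

text \<open>After division of \<open>r\<close> and \<open>s\<close> by their gcd \<open>g\<close>
  the condition reads \<open>r' dvd e\<close> with \<open>r = g * r'\<close>, which has
  \<open>g\<close> solutions in the interval. In effect this counts the \<open>s\<close>-torsion of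
  a cyclic group of order \<open>r\<close>.\<close>

lemma card_multiples_in_interval:
  fixes r s :: nat
  assumes "r > 0"
  shows "card {e \<in> {0..<int r}. int r dvd int s * e} = gcd s r"
proof -
  define g where "g = gcd s r"
  have g: "g > 0" using assms by (simp add: g_def)
  obtain s' r' where rs': "s = s' * g" "r = r' * g" "coprime s' r'"
    using gcd_coprime_exists[of s r] g unfolding g_def by blast
  then have rs: "r = g * r'" "s = g * s'" "coprime s' r'" by (simp_all only: mult.commute)
  have r': "r' > 0" using rs(1) assms by (cases r') auto
  have dvd: "int r dvd int s * e \<longleftrightarrow> int r' dvd e" for e
  proof -
    have "int r dvd int s * e \<longleftrightarrow> int g * int r' dvd int g * (int s' * e)"
      by (simp add: rs mult.assoc)
    also have "\<dots> \<longleftrightarrow> int r' dvd int s' * e" using g by simp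
    also have "\<dots> \<longleftrightarrow> int r' dvd e"
      using rs(3) by (simp add: coprime_dvd_mult_right_iff coprime_commute)
    finally show ?thesis .
  qed
  have "{e \<in> {0..<int r}. int r dvd int s * e} = (\<lambda>j. int r' * j) ` {0..<int g}"
  proof (intro equalityI subsetI)
    fix e assume "e \<in> {e \<in> {0..<int r}. int r dvd int s * e}"
    then have "0 \<le> e" "e < int r" "int r' dvd e" by (simp_all add: dvd)
    then have e: "0 \<le> e" "e < int r' * int g" "int r' dvd e" by (simp_all add: rs'(2))
    then obtain j where j: "e = int r' * j" by auto
    then have "0 \<le> j" "j < int g" using e r' by (auto simp: zero_le_mult_iff)
    then show "e \<in> (\<lambda>j. int r' * j) ` {0..<int g}" using j by auto
  next
    fix e assume "e \<in> (\<lambda>j. int r' * j) ` {0..<int g}"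
    then obtain j where "e = int r' * j" "j \<in> {0..<int g}" by blast
    then show "e \<in> {e \<in> {0..<int r}. int r dvd int s * e}"
      using r' by (simp add: dvd) (simp add: rs'(2))
  qed
  moreover have "inj_on (\<lambda>j. int r' * j) {0..<int g}" using r' by (auto simp: inj_on_def)
  ultimately show ?thesis by (simp add: card_image g_def)
qed

section \<open>Calculus with power products\<close>

context comm_group
begin

lemma power_prod_0 [simp]: "power_prod G 0 b e = \<one>" by (simp add: power_prod_def)

lemma power_prod_closed [intro, simp]: "\<forall>i<k. b i \<in> carrier G \<Longrightarrow> power_prod G k b e \<in> carrier G"
  by (auto simp: power_prod_def intro!: finprod_closed)

lemma power_prod_cong:
  assumes "\<forall>i<k. b i \<in> carrier G" "\<And>i. i < k \<Longrightarrow> b i = b' i" "\<And>i. i < k \<Longrightarrow> e i = e' i"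
  shows "power_prod G k b e = power_prod G k b' e'"
  unfolding power_prod_def using assms by (intro finprod_cong') auto

lemma power_prod_Suc:
  "\<forall>i<Suc k. b i \<in> carrier G \<Longrightarrow> power_prod G (Suc k) b e = power_prod G k b e \<otimes> b k [^] e k"
  unfolding power_prod_def lessThan_Suc by (subst finprod_insert) (auto simp: m_comm)

lemma power_prod_add:
  "\<forall>i<k. b i \<in> carrier G \<Longrightarrow> power_prod G k b (\<lambda>i. e i + e' i) = power_prod G k b e \<otimes> power_prod G k b e'"
proof -
  assume c: "\<forall>i<k. b i \<in> carrier G"
  then have "power_prod G k b (\<lambda>i. e i + e' i) = (\<Otimes>i\<in>{..<k}. b i [^] e i \<otimes> b i [^] e' i)"
    unfolding power_prod_def by (intro finprod_cong') (auto simp: int_pow_mult)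
  also have "\<dots> = power_prod G k b e \<otimes> power_prod G k b e'"
    unfolding power_prod_def by (rule finprod_multf) (use c in auto)
  finally show ?thesis .
qed

lemma power_prod_mult:
  fixes n :: int
  shows "\<forall>i<k. b i \<in> carrier G \<Longrightarrow> power_prod G k b (\<lambda>i. n * e i) = power_prod G k b e [^] n"
proof (induction k)
  case (Suc k)
  then show ?case
    by (simp add: power_prod_Suc int_pow_distrib int_pow_pow mult.commute)
qed simp

lemma power_prod_diff:
  assumes "\<forall>i<k. b i \<in> carrier G"
  shows "power_prod G k b (\<lambda>i. e i - e' i) = power_prod G k b e \<otimes> inv (power_prod G k b e')"
  using power_prod_add[OF assms, of e "\<lambda>i. - 1 * e' i"] assms power_prod_mult[OF assms, of "-1" e']
  by (simp add: int_pow_neg)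

lemma power_prod_unit:
  assumes "\<forall>i<k. b i \<in> carrier G" "j < k"
  shows "power_prod G k b (\<lambda>i. if i = j then n else 0) = b j [^] n"
  using assms
proof (induction k)
  case (Suc k)
  have z: "power_prod G k b (\<lambda>i. if i = k then n else 0) = \<one>"
    using Suc.prems unfolding power_prod_def by (intro finprod_one_eqI) auto
  show ?case
  proof (cases "j = k")
    case True
    then show ?thesis using Suc.prems z by (auto simp: power_prod_Suc)
  next
    case False
    then show ?thesis using Suc by (simp add: power_prod_Suc)
  qed
qed simp

lemma power_prod_eq_one:
  assumes "\<forall>i<k. b i \<in> carrier G \<and> b i [^] r i = \<one>" "\<forall>i<k. int (r i) dvd e i"
  shows "power_prod G k b e = \<one>"
  unfolding power_prod_def
proof (intro finprod_one_eqI)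
  fix i assume "i \<in> {..<k}"
  then have "i < k" by simp
  then obtain c where "e i = int (r i) * c" using assms(2) by auto
  moreover have "b i [^] (int (r i) * c) = (b i [^] int (r i)) [^] c"
    using assms(1) \<open>i < k\<close> by (simp add: int_pow_pow)
  ultimately show "b i [^] e i = \<one>" using assms(1) \<open>i < k\<close> by (simp add: int_pow_int)
qed

lemma indep_carrier: "indep G r k b \<Longrightarrow> \<forall>i<k. b i \<in> carrier G"
  by (simp add: indep_def)

lemma power_prod_eq_one_iff:
  assumes "indep G r k b"
  shows "power_prod G k b e = \<one> \<longleftrightarrow> (\<forall>i<k. int (r i) dvd e i)"
  using assms power_prod_eq_one[of k b r e] unfolding indep_def by blast

text \<open>\<open>power_prod\<close> is a homomorphism on exponent vectors, so equality of values
  is a statement about its kernel.\<close>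

lemma power_prod_eq_iff:
  assumes "indep G r k b"
  shows "power_prod G k b e = power_prod G k b e' \<longleftrightarrow> (\<forall>i<k. int (r i) dvd e i - e' i)"
proof -
  have c: "\<forall>i<k. b i \<in> carrier G" using assms by (rule indep_carrier)
  have "x \<otimes> inv y = \<one> \<Longrightarrow> x = y" if "x \<in> carrier G" "y \<in> carrier G" for x y
    using that inv_equality[of x "inv y"] by simp
  then have "power_prod G k b e = power_prod G k b e' \<longleftrightarrow> power_prod G k b (\<lambda>i. e i - e' i) = \<one>"
    using c by (auto simp: power_prod_diff)
  then show ?thesis using power_prod_eq_one_iff[OF assms] by simp
qed

lemma power_prod_mod:
  assumes "\<forall>i<k. b i \<in> carrier G \<and> b i [^] r i = \<one>"
  shows "power_prod G k b (\<lambda>i. e i mod int (r i)) = power_prod G k b e"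
proof -
  have c: "\<forall>i<k. b i \<in> carrier G" using assms by blast
  have "power_prod G k b e = power_prod G k b (\<lambda>i. e i mod int (r i) + int (r i) * (e i div int (r i)))"
    by (rule arg_cong[where f = "power_prod G k b"]) simp
  also have "\<dots> = power_prod G k b (\<lambda>i. e i mod int (r i)) \<otimes> power_prod G k b (\<lambda>i. int (r i) * (e i div int (r i)))"
    by (rule power_prod_add[OF c])
  also have "power_prod G k b (\<lambda>i. int (r i) * (e i div int (r i))) = \<one>"
    by (rule power_prod_eq_one[OF assms]) simp
  finally show ?thesis using power_prod_closed[OF c] by simp
qed

lemma power_prod_restrict:
  assumes "\<forall>i<k. b i \<in> carrier G"
  shows "power_prod G k b (restrict e {..<k}) = power_prod G k b e"
  using assms by (intro power_prod_cong) auto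

section \<open>Exponents modulo the orders\<close>

text \<open>Reducing the exponent of \<open>b i\<close> modulo \<open>r i\<close> leaves the product
  alone, as the \<open>r i\<close>-th power of \<open>b i\<close> is the identity.\<close>

lemma range_power_prod_box:
  assumes "\<forall>i<k. b i \<in> carrier G \<and> b i [^] r i = \<one>" and "\<forall>i<k. 0 < r i"
  shows "range (power_prod G k b) = power_prod G k b ` exponent_box r k"
proof (intro equalityI subsetI)
  fix x assume "x \<in> range (power_prod G k b)"
  then obtain e where x: "x = power_prod G k b e" by blast
  have c: "\<forall>i<k. b i \<in> carrier G" using assms(1) by blast
  have "x = power_prod G k b (restrict (\<lambda>i. e i mod int (r i)) {..<k})"
    unfolding x power_prod_restrict[OF c] by (rule power_prod_mod[OF assms(1), symmetric])
  moreover have "restrict (\<lambda>i. e i mod int (r i)) {..<k} \<in> exponent_box r k"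
    unfolding exponent_box_def using assms(2) by (intro restrict_PiE_iff[THEN iffD2]) simp
  ultimately show "x \<in> power_prod G k b ` exponent_box r k" by (rule image_eqI)
qed blast

lemma card_exponent_box: "card (exponent_box r k) = (\<Prod>i<k. r i)"
  by (simp add: exponent_box_def card_PiE)

lemma finite_exponent_box: "finite (exponent_box r k)"
  unfolding exponent_box_def by (intro finite_PiE) auto

lemma inj_on_power_prod_box:
  assumes "indep G r k b"
  shows "inj_on (power_prod G k b) (exponent_box r k)"
proof (rule inj_onI)
  fix e e' assume e: "e \<in> exponent_box r k" "e' \<in> exponent_box r k" and eq: "power_prod G k b e = power_prod G k b e'"
  show "e = e'"
  proof (rule PiE_ext)
    show "e \<in> (\<Pi>\<^sub>E i\<in>{..<k}. {0..<int (r i)})" "e' \<in> (\<Pi>\<^sub>E i\<in>{..<k}. {0..<int (r i)})"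
      using e unfolding exponent_box_def by blast+
    fix i assume i: "i \<in> {..<k}"
    then have b: "e i \<in> {0..<int (r i)}" "e' i \<in> {0..<int (r i)}"
      using e[unfolded exponent_box_def, THEN PiE_mem, OF i] by blast+
    have "int (r i) dvd e i - e' i" using eq i unfolding power_prod_eq_iff[OF assms] by simp
    then have "e i mod int (r i) = e' i mod int (r i)" by (simp only: mod_eq_dvd_iff)
    moreover have "e i mod int (r i) = e i" "e' i mod int (r i) = e' i" using b by (simp_all only: atLeastLessThan_iff mod_pos_pos_trivial)
    ultimately show "e i = e' i" by (simp only:)
  qed
qed

text \<open>The box embeds into the group and has as many elements as the group.\<close>

lemma range_power_prod_eq_carrier:
  assumes "indep G r k b" and "\<forall>i<k. 0 < r i" and "card (carrier G) = (\<Prod>i<k. r i)"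
  shows "range (power_prod G k b) = carrier G"
proof -
  have c: "\<forall>i<k. b i \<in> carrier G \<and> b i [^] r i = \<one>" using assms(1) by (simp add: indep_def)
  have "0 < card (carrier G)" using assms(2) unfolding assms(3) by (intro prod_pos) auto
  then have "finite (carrier G)" by (rule card_ge_0_finite)
  moreover have "range (power_prod G k b) \<subseteq> carrier G" using c by auto
  moreover have "card (range (power_prod G k b)) = card (carrier G)"
    unfolding range_power_prod_box[OF c assms(2)] card_image[OF inj_on_power_prod_box[OF assms(1)]] card_exponent_box
    using assms(3) by simp
  ultimately show ?thesis by (rule card_subset_eq)
qed

text \<open>Pigeonhole: the box maps onto a set of its own size, hence injectively. A relation and
  the zero vector then have the same reduction in the box.\<close>

lemma indep_if_generating:
  assumes "\<forall>i<k. b i \<in> carrier G \<and> b i [^] r i = \<one>" and "\<forall>i<k. 0 < r i"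
    and "card (carrier G) = (\<Prod>i<k. r i)" and "carrier G \<subseteq> range (power_prod G k b)"
  shows "indep G r k b"
  unfolding indep_def
proof (intro conjI allI impI)
  have c: "\<forall>i<k. b i \<in> carrier G" using assms(1) by blast
  then have "power_prod G k b ` exponent_box r k = carrier G"
    using assms(4) range_power_prod_box[OF assms(1,2)] power_prod_closed[OF c] by blast
  then have inj: "inj_on (power_prod G k b) (exponent_box r k)"
    using assms(3) by (intro eq_card_imp_inj_on finite_exponent_box) (simp add: card_exponent_box)
  fix e i assume e: "power_prod G k b e = \<one>" and i: "i < k"
  \<comment> \<open>Restriction makes both vectors extensional, as membership in the box
    demands.\<close>
  have "power_prod G k b (restrict (\<lambda>i. e i mod int (r i)) {..<k}) = power_prod G k b (restrict (\<lambda>i. 0) {..<k})"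
    using power_prod_restrict[OF c] power_prod_mod[OF assms(1), of e] e power_prod_eq_one[OF assms(1), of "\<lambda>i. 0"] by simp
  moreover have "restrict (\<lambda>i. e i mod int (r i)) {..<k} \<in> exponent_box r k"
      "restrict (\<lambda>i. 0) {..<k} \<in> exponent_box r k"
    using assms(2) by (simp_all add: exponent_box_def PiE_iff)
  ultimately have "restrict (\<lambda>i. e i mod int (r i)) {..<k} = restrict (\<lambda>i. 0) {..<k}"
    by (rule inj_onD[OF inj])
  from fun_cong[OF this, of i] have "e i mod int (r i) = 0" using i by simp
  then show "int (r i) dvd e i" by (simp only: mod_eq_0_iff_dvd)
qed (use assms(1) in blast)+

text \<open>In exponent coordinates the equation \<open>x [^] s = \<one>\<close> splits into one
  divisibility per coordinate, so the count is a product of counts in cyclic groups.\<close>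

lemma card_torsion_span:
  fixes s :: nat
  assumes "indep G r k b" and "\<forall>i<k. 0 < r i"
  shows "card {x \<in> range (power_prod G k b). x [^] s = \<one>} = (\<Prod>i<k. gcd s (r i))"
proof -
  have c: "\<forall>i<k. b i \<in> carrier G \<and> b i [^] r i = \<one>" using assms(1) by (simp add: indep_def)
  then have c': "\<forall>i<k. b i \<in> carrier G" by blast
  define B where "B = (\<Pi>\<^sub>E i\<in>{..<k}. {e \<in> {0..<int (r i)}. int (r i) dvd int s * e})"
  have BE: "B = {e \<in> exponent_box r k. \<forall>i<k. int (r i) dvd int s * e i}"
    unfolding B_def exponent_box_def by (rule Set.set_eqI) (simp add: PiE_iff ball_conj_distrib, blast)
  have tors: "power_prod G k b e [^] s = \<one> \<longleftrightarrow> (\<forall>i<k. int (r i) dvd int s * e i)" for e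
    using power_prod_mult[OF c', of "int s" e] power_prod_eq_one_iff[OF assms(1), of "\<lambda>i. int s * e i"]
    by (simp add: int_pow_int)
  have "{x \<in> range (power_prod G k b). x [^] s = \<one>} = power_prod G k b ` B"
    unfolding range_power_prod_box[OF c assms(2)] BE using tors by blast
  moreover have "inj_on (power_prod G k b) B"
    using inj_on_power_prod_box[OF assms(1)] by (rule inj_on_subset) (auto simp: BE)
  ultimately have "card {x \<in> range (power_prod G k b). x [^] s = \<one>} = card B" by (simp add: card_image)
  also have "\<dots> = (\<Prod>i<k. gcd s (r i))"
    unfolding B_def card_PiE[OF finite_lessThan]
    using assms(2) by (intro prod.cong card_multiples_in_interval) simp_all
  finally show ?thesis .
qed

section \<open>Extending an independent tuple by an element of prime order\<close>

text \<open>As \<open>r k\<close> is prime, every power of \<open>x\<close> other than the identity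
  generates the same cyclic group as \<open>x\<close>. This group therefore meets the span of
  \<open>b\<close> trivially as soon as \<open>x\<close> itself lies outside the span.\<close>

lemma indep_Suc_iff:
  assumes b: "indep G r k b" and x: "x \<in> carrier G" and p: "prime (r k)"
  shows "indep G r (Suc k) (b(k := x)) \<longleftrightarrow> x [^] r k = \<one> \<and> x \<notin> range (power_prod G k b)"
proof -
  have c: "\<forall>i<k. b i \<in> carrier G \<and> b i [^] r i = \<one>" using b by (simp add: indep_def)
  then have c': "\<forall>i<k. b i \<in> carrier G" by blast
  have expand: "power_prod G (Suc k) (b(k := x)) e = power_prod G k b e \<otimes> x [^] e k" for e
    using c x by (subst power_prod_Suc) (auto intro!: arg_cong2[where f = "(\<otimes>)"] power_prod_cong)
  show ?thesis
  proof
    assume L: "indep G r (Suc k) (b(k := x))"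
    then have "x [^] r k = \<one>" by (auto simp: indep_def)
    moreover have False if mem: "x \<in> range (power_prod G k b)"
    proof -
      obtain e where e: "x = power_prod G k b e" using mem by auto
      \<comment> \<open>The exponent -1 at \<open>k\<close> turns the expression of \<open>x\<close>
        by \<open>b\<close> into a relation, and the prime \<open>r k\<close> does not divide
        -1.\<close>
      define e' where "e' = (\<lambda>i. if i = k then -1 else e i)"
      have "power_prod G k b e' = x" unfolding e by (rule power_prod_cong) (use c in \<open>auto simp: e'_def\<close>)
      then have "power_prod G (Suc k) (b(k := x)) e' = \<one>" using x by (simp add: expand e'_def int_pow_neg)
      then have "int (r k) dvd e' k" using L unfolding indep_def by blast
      then show False using p not_prime_unit[of "int (r k)"] by (simp add: e'_def)
    qed
    ultimately show "x [^] r k = \<one> \<and> x \<notin> range (power_prod G k b)" by blast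
  next
    assume R: "x [^] r k = \<one> \<and> x \<notin> range (power_prod G k b)"
    have "int (r i) dvd e i" if e: "power_prod G (Suc k) (b(k := x)) e = \<one>" and i: "i < Suc k" for e i
    proof -
      have e1: "power_prod G k b e \<otimes> x [^] e k = \<one>" using e expand by simp
      have k: "int (r k) dvd e k"
      proof (rule ccontr)
        assume "\<not> int (r k) dvd e k"
        then have "coprime (e k) (int (r k))"
          using p by (metis prime_imp_coprime prime_nat_int_transfer coprime_commute)
        \<comment> \<open>By Bezout, \<open>x\<close> is a product of a power of
          \<open>x [^] e k\<close>, which lies in the span of \<open>b\<close>, and a power of
          \<open>x [^] r k = \<one>\<close>. So \<open>x\<close> would lie in the span.\<close>
        then obtain u v where uv: "u * e k + v * int (r k) = 1"
          by (metis bezout_int coprime_imp_gcd_eq_1)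
        have "x = x [^] (u * e k + v * int (r k))" using x uv by simp
        also have "\<dots> = (x [^] e k) [^] u \<otimes> (x [^] int (r k)) [^] v"
          using x by (simp add: int_pow_mult int_pow_pow mult.commute)
        also have "x [^] int (r k) = \<one>" using R by (simp add: int_pow_int)
        also have "x [^] e k = inv (power_prod G k b e)"
          using e1 x c' by (metis power_prod_closed int_pow_closed inv_equality m_comm)
        also have "\<dots> = power_prod G k b (\<lambda>i. -1 * e i)" 
          using c' by (simp only: power_prod_mult int_pow_neg power_prod_closed) (simp add: int_pow_neg)
        also have "\<dots> [^] u \<otimes> \<one> [^] v = power_prod G k b (\<lambda>i. u * (-1 * e i))"
          using c' by (simp only: power_prod_mult) simp
        finally show False using R by blast
      qed
      show ?thesis
      proof (cases "i = k")
        case False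
        obtain d where "e k = int (r k) * d" using k by auto
        then have "x [^] e k = (x [^] int (r k)) [^] d" using x by (simp add: int_pow_pow)
        then have "x [^] e k = \<one>" using R by (simp add: int_pow_int)
        then have "power_prod G k b e = \<one>" using e1 c' by simp
        then show ?thesis using b False i unfolding indep_def by auto
      qed (use k in simp)
    qed
    then show "indep G r (Suc k) (b(k := x))" using c R x unfolding indep_def by auto
  qed
qed

lemma indep_cong:
  assumes "\<And>i. i < k \<Longrightarrow> b i = b' i"
  shows "indep G r k b \<longleftrightarrow> indep G r k b'"
proof (cases "\<forall>i<k. b i \<in> carrier G")
  case True
  then have "power_prod G k b e = power_prod G k b' e" for e using assms by (intro power_prod_cong) auto
  then show ?thesis using assms by (auto simp: indep_def)
qed (use assms in \<open>auto simp: indep_def\<close>)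

text \<open>The form needed for counting: the fibre over an independent tuple \<open>b\<close> is
  the \<open>r k\<close>-torsion without the span of \<open>b\<close>.\<close>

lemma indep_tuples_Suc:
  assumes p: "prime (r k)"
  shows "bij_betw (\<lambda>(b, x). b(k := x))
    (SIGMA b : indep_tuples G r k. {x \<in> carrier G. x [^] r k = \<one>} - range (power_prod G k b))
    (indep_tuples G r (Suc k))"
proof (rule bij_betwI')
  fix y z
  assume "y \<in> (SIGMA b : indep_tuples G r k. {x \<in> carrier G. x [^] r k = \<one>} - range (power_prod G k b))"
    "z \<in> (SIGMA b : indep_tuples G r k. {x \<in> carrier G. x [^] r k = \<one>} - range (power_prod G k b))"
  then obtain b x b' x' where yz: "y = (b, x)" "z = (b', x')"
      "b \<in> {..<k} \<rightarrow>\<^sub>E carrier G" "b' \<in> {..<k} \<rightarrow>\<^sub>E carrier G"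
    by (auto simp: indep_tuples_def)
  have "b = b'" if "b(k := x) = b'(k := x')"
  proof (rule PiE_ext[OF yz(3,4)])
    fix i assume "i \<in> {..<k}"
    then show "b i = b' i" using fun_cong[OF that, of i] by simp
  qed
  then show "((case y of (b, x) \<Rightarrow> b(k := x)) = (case z of (b, x) \<Rightarrow> b(k := x))) = (y = z)"
    unfolding yz by (auto dest: fun_upd_eqD)
next
  fix y
  assume "y \<in> (SIGMA b : indep_tuples G r k. {x \<in> carrier G. x [^] r k = \<one>} - range (power_prod G k b))"
  then show "(case y of (b, x) \<Rightarrow> b(k := x)) \<in> indep_tuples G r (Suc k)"
    using p by (auto simp: indep_tuples_def indep_Suc_iff lessThan_Suc PiE_iff extensional_def)
next
  fix y assume y: "y \<in> indep_tuples G r (Suc k)"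
  define b where "b = restrict y {..<k}"
  have yk: "y = b(k := y k)"
    using y by (auto simp: indep_tuples_def b_def fun_eq_iff PiE_iff extensional_def)
  have i: "indep G r (Suc k) y" and c: "y \<in> {..<Suc k} \<rightarrow> carrier G"
    using y by (auto simp: indep_tuples_def)
  have "indep G r k y"
    unfolding indep_def
  proof (intro conjI allI impI)
    fix e j assume e: "power_prod G k y e = \<one>" and j: "j < k"
    have yc: "\<forall>i<Suc k. y i \<in> carrier G" using c by auto
    \<comment> \<open>Exponent 0 at \<open>k\<close> turns a relation among the first
      \<open>k\<close> entries into one among all of them.\<close>
    have "power_prod G (Suc k) y (\<lambda>i. if i = k then 0 else e i) = power_prod G k y (\<lambda>i. if i = k then 0 else e i)"
      unfolding power_prod_Suc[OF yc] using yc by simp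
    also have "\<dots> = power_prod G k y e" by (rule power_prod_cong) (simp_all add: yc)
    finally have "power_prod G (Suc k) y (\<lambda>i. if i = k then 0 else e i) = \<one>" unfolding e .
    then have "\<forall>j<Suc k. int (r j) dvd (if j = k then 0 else e j)" using i unfolding indep_def by blast
    then show "int (r j) dvd e j" using j by (auto dest: spec[of _ j])
  qed (use i in \<open>auto simp: indep_def\<close>)
  then have b: "indep G r k b" using indep_cong[of k y b r] by (simp add: b_def)
  have yk': "y k \<in> carrier G" using c by auto
  have "y k [^] r k = \<one> \<and> y k \<notin> range (power_prod G k b)"
    using indep_Suc_iff[of r k b "y k", OF b yk' p, folded yk] i by (rule iffD1)
  moreover have "b \<in> {..<k} \<rightarrow>\<^sub>E carrier G" using c by (auto simp: b_def)
  ultimately have mem: "(b, y k) \<in> (SIGMA b : indep_tuples G r k. {x \<in> carrier G. x [^] r k = \<one>} - range (power_prod G k b))"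
    using b yk' by (auto simp: indep_tuples_def)
  show "\<exists>z\<in>(SIGMA b : indep_tuples G r k. {x \<in> carrier G. x [^] r k = \<one>} - range (power_prod G k b)).
      y = (case z of (b, x) \<Rightarrow> b(k := x))"
    by (rule bexI[OF _ mem], unfold prod.case, rule yk)
qed

end

section \<open>Isomorphisms and independent tuples\<close>

text \<open>Extensionality identifies isomorphisms that agree on the carrier, so that they can be
  counted.\<close>

definition isos :: "('g, 'm) monoid_scheme \<Rightarrow> ('h, 'n) monoid_scheme \<Rightarrow> ('g \<Rightarrow> 'h) set" where
  "isos G H = iso G H \<inter> extensional (carrier G)"

lemma hom_power_prod:
  assumes "comm_group G" "comm_group H" "h \<in> hom G H" "\<forall>i<k. a i \<in> carrier G"
  shows "h (power_prod G k a e) = power_prod H k (\<lambda>i. h (a i)) e"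
proof -
  interpret G: comm_group G by fact
  interpret H: comm_group H by fact
  interpret group_hom G H h by unfold_locales (rule assms(3))
  show ?thesis
    using assms(4)
  proof (induction k)
    case (Suc k)
    then show ?case by (simp add: G.power_prod_Suc H.power_prod_Suc hom_int_pow)
  qed simp
qed

text \<open>By the order condition \<open>a\<close> generates \<open>G\<close>, so a homomorphism is
  determined by the images of the \<open>a i\<close>. Conversely every independent tuple of
  \<open>H\<close> generates \<open>H\<close>, and matching exponents with respect to the two tuples
  gives an isomorphism.\<close>

lemma isos_indep_tuples:
  assumes "comm_group G" "comm_group H"
    and a: "indep G r k a" and r: "\<forall>i<k. 0 < r i"
    and "card (carrier G) = (\<Prod>i<k. r i)" "card (carrier H) = card (carrier G)"
  shows "bij_betw (\<lambda>h. \<lambda>i\<in>{..<k}. h (a i)) (isos G H) (indep_tuples H r k)"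
proof -
  interpret G: comm_group G by fact
  interpret H: comm_group H by fact
  have ac: "\<forall>i<k. a i \<in> carrier G" using a by (rule G.indep_carrier)
  have gen: "range (power_prod G k a) = carrier G" using a r assms(5) by (rule G.range_power_prod_eq_carrier)
  show ?thesis
  proof (rule bij_betwI')
    fix h h' assume h: "h \<in> isos G H" "h' \<in> isos G H"
    have "h = h'" if eq: "(\<lambda>i\<in>{..<k}. h (a i)) = (\<lambda>i\<in>{..<k}. h' (a i))"
    proof (rule extensionalityI)
      show "h \<in> extensional (carrier G)" "h' \<in> extensional (carrier G)" using h by (auto simp: isos_def)
      fix x assume "x \<in> carrier G"
      then obtain e where x: "x = power_prod G k a e" using gen by auto
      have eq': "h (a i) = h' (a i)" if "i < k" for i using fun_cong[OF eq, of i] that by simp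
      have hom: "h \<in> hom G H" "h' \<in> hom G H" using h by (auto simp: isos_def iso_def)
      then have "\<forall>i<k. h (a i) \<in> carrier H" using ac by (auto simp: hom_def)
      then show "h x = h' x"
        unfolding x hom_power_prod[OF assms(1,2) hom(1) ac] hom_power_prod[OF assms(1,2) hom(2) ac]
        by (rule H.power_prod_cong) (simp_all add: eq')
    qed
    then show "((\<lambda>i\<in>{..<k}. h (a i)) = (\<lambda>i\<in>{..<k}. h' (a i))) = (h = h')" by auto
  next
    fix h assume "h \<in> isos G H"
    then have hom: "h \<in> hom G H" and inj: "inj_on h (carrier G)"
      by (auto simp: isos_def iso_def bij_betw_def)
    interpret h: group_hom G H h by unfold_locales (rule hom)
    have "indep H r k (\<lambda>i. h (a i))"
      unfolding indep_def
    proof (intro conjI allI impI)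
      fix i assume "i < k"
      then have "a i \<in> carrier G" "a i [^]\<^bsub>G\<^esub> r i = \<one>\<^bsub>G\<^esub>" using a by (auto simp: indep_def)
      then show "h (a i) \<in> carrier H" "h (a i) [^]\<^bsub>H\<^esub> r i = \<one>\<^bsub>H\<^esub>"
        using h.hom_nat_pow[of "a i" "r i"] by auto
    next
      fix e i assume e: "power_prod H k (\<lambda>i. h (a i)) e = \<one>\<^bsub>H\<^esub>" and i: "i < k"
      then have "h (power_prod G k a e) = h \<one>\<^bsub>G\<^esub>" using hom_power_prod[OF assms(1,2) hom ac, of e] by simp
      then have "power_prod G k a e = \<one>\<^bsub>G\<^esub>" using ac by (intro inj_onD[OF inj]) auto
      then show "int (r i) dvd e i" using a i by (simp add: indep_def)
    qed
    then have "indep H r k (\<lambda>i\<in>{..<k}. h (a i))" using H.indep_cong[of k "\<lambda>i. h (a i)" "\<lambda>i\<in>{..<k}. h (a i)" r] by simp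
    then show "(\<lambda>i\<in>{..<k}. h (a i)) \<in> indep_tuples H r k"
      using ac by (auto simp: indep_tuples_def)
  next
    fix b assume "b \<in> indep_tuples H r k"
    then have b: "indep H r k b" "b \<in> {..<k} \<rightarrow>\<^sub>E carrier H" by (auto simp: indep_tuples_def)
    have bc: "\<forall>i<k. b i \<in> carrier H" using b(1) by (rule H.indep_carrier)
    have genH: "range (power_prod H k b) = carrier H" using b(1) r assms(5,6) by (intro H.range_power_prod_eq_carrier) auto
    \<comment> \<open>The chosen \<open>e\<close> is irrelevant: two exponent vectors give the same
      product over \<open>a\<close> exactly when they agree modulo the \<open>r i\<close>, and the
      same holds over \<open>b\<close>.\<close>
    define h where "h = (\<lambda>g\<in>carrier G. power_prod H k b (SOME e. power_prod G k a e = g))"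
    have h: "h (power_prod G k a e) = power_prod H k b e" for e
    proof -
      have "power_prod G k a (SOME e'. power_prod G k a e' = power_prod G k a e) = power_prod G k a e"
        by (rule someI[of _ e]) simp
      then show ?thesis
        using ac by (simp add: h_def G.power_prod_eq_iff[OF a] H.power_prod_eq_iff[OF b(1)])
    qed
    have "h \<in> hom G H"
    proof (rule homI)
      fix x assume "x \<in> carrier G"
      then show "h x \<in> carrier H" using bc by (simp add: h_def)
    next
      fix x y assume "x \<in> carrier G" "y \<in> carrier G"
      then obtain e e' where xy: "x = power_prod G k a e" "y = power_prod G k a e'" using gen by (metis imageE)
      then have "x \<otimes>\<^bsub>G\<^esub> y = power_prod G k a (\<lambda>i. e i + e' i)" using G.power_prod_add[OF ac] by simp
      then show "h (x \<otimes>\<^bsub>G\<^esub> y) = h x \<otimes>\<^bsub>H\<^esub> h y" using xy h H.power_prod_add[OF bc] by simp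
    qed
    moreover have "inj_on h (carrier G)"
    proof (rule inj_onI)
      fix x y assume "x \<in> carrier G" "y \<in> carrier G" "h x = h y"
      moreover from this obtain e e' where "x = power_prod G k a e" "y = power_prod G k a e'" using gen by (metis imageE)
      ultimately show "x = y" using h by (simp add: G.power_prod_eq_iff[OF a] H.power_prod_eq_iff[OF b(1)])
    qed
    moreover have "h ` carrier G = carrier H"
      unfolding gen [symmetric] genH [symmetric] image_image h ..
    ultimately have "h \<in> isos G H" by (simp add: isos_def iso_def bij_betw_def h_def)
    moreover have "h (a i) = b i" if "i < k" for i
    proof -
      have "a i = power_prod G k a (\<lambda>j. if j = i then 1 else 0)" using G.power_prod_unit[OF ac that, of 1] ac that by simp
      then have "h (a i) = power_prod H k b (\<lambda>j. if j = i then 1 else 0)" using h by metis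
      then show ?thesis using H.power_prod_unit[OF bc that, of 1] bc that by simp
    qed
    then have "b = (\<lambda>i\<in>{..<k}. h (a i))" using b(2) by (auto simp: fun_eq_iff PiE_iff extensional_def)
    ultimately show "\<exists>h\<in>isos G H. b = (\<lambda>i\<in>{..<k}. h (a i))" by blast
  qed
qed

section \<open>Counting independent tuples of orders \<open>p ^ \<delta>, p, ..., p\<close>\<close>

text \<open>Independence of one element means order exactly \<open>p ^ \<delta>\<close>. The order
  divides this prime power, so it is smaller only if it divides
  \<open>p ^ (\<delta> - 1)\<close>.\<close>

lemma (in comm_group) indep_one_iff:
  assumes p: "prime p" and x: "x \<in> carrier G" "x [^] (p ^ \<delta>) = \<one>" and "0 < \<delta>"
    and r: "r 0 = p ^ \<delta>" and b: "b 0 = x"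
  shows "indep G r (Suc 0) b \<longleftrightarrow> x [^] (p ^ (\<delta> - 1)) \<noteq> \<one>"
proof -
  have expand: "power_prod G (Suc 0) b e = x [^] e 0" for e using x b by (simp add: power_prod_Suc)
  have "indep G r (Suc 0) b \<longleftrightarrow> (\<forall>e :: nat \<Rightarrow> int. x [^] e 0 = \<one> \<longrightarrow> int (p ^ \<delta>) dvd e 0)"
    using x r b by (auto simp: indep_def expand)
  also have "\<dots> \<longleftrightarrow> (\<forall>n::int. x [^] n = \<one> \<longrightarrow> int (p ^ \<delta>) dvd n)" (is "?L \<longleftrightarrow> ?R")
  proof
    assume ?L
    then have "x [^] (\<lambda>_. n) 0 = \<one> \<longrightarrow> int (p ^ \<delta>) dvd (\<lambda>_. n) (0::nat)" for n :: int by (rule spec)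
    then show ?R by blast
  qed blast
  also have "\<dots> \<longleftrightarrow> x [^] (p ^ (\<delta> - 1)) \<noteq> \<one>"
  proof
    assume R: "\<forall>n::int. x [^] n = \<one> \<longrightarrow> int (p ^ \<delta>) dvd n"
    have "\<not> p ^ \<delta> dvd p ^ (\<delta> - 1)"
      unfolding dvd_power_iff_le[OF prime_ge_2_nat[OF p]] using \<open>0 < \<delta>\<close> by simp
    then show "x [^] (p ^ (\<delta> - 1)) \<noteq> \<one>"
      using R[rule_format, of "int (p ^ (\<delta> - 1))"] unfolding int_pow_int int_dvd_int_iff by blast
  next
    assume ne: "x [^] (p ^ (\<delta> - 1)) \<noteq> \<one>"
    show "\<forall>n::int. x [^] n = \<one> \<longrightarrow> int (p ^ \<delta>) dvd n"
    proof (intro allI impI)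
      fix n :: int assume n: "x [^] n = \<one>"
      \<comment> \<open>By Bezout the gcd \<open>g\<close> also annihilates \<open>x\<close>. It is
        a power of \<open>p\<close>, and an exponent below \<open>\<delta>\<close> would contradict
        \<open>ne\<close>.\<close>
      define g where "g = nat (gcd n (int (p ^ \<delta>)))"
      have g: "int g = gcd n (int (p ^ \<delta>))" by (simp add: g_def)
      obtain u v where uv: "u * n + v * int (p ^ \<delta>) = int g" unfolding g using bezout_int by blast
      have "x [^] int g = (x [^] n) [^] u \<otimes> (x [^] int (p ^ \<delta>)) [^] v"
        unfolding uv[symmetric] using x(1) by (simp only: int_pow_mult int_pow_pow mult.commute)
      also have "x [^] int (p ^ \<delta>) = \<one>" unfolding int_pow_int by (rule x(2))
      finally have xg: "x [^] g = \<one>" using n by (simp add: int_pow_int)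
      have "int g dvd int (p ^ \<delta>)" unfolding g by (rule gcd_dvd2)
      then have "g dvd p ^ \<delta>" by (simp only: int_dvd_int_iff)
      then obtain i where i: "i \<le> \<delta>" "g = p ^ i" using p by (metis divides_primepow_nat)
      have "\<not> i \<le> \<delta> - 1"
      proof
        assume "i \<le> \<delta> - 1"
        then have "g dvd p ^ (\<delta> - 1)" unfolding i(2) by (rule le_imp_power_dvd)
        then obtain m where "p ^ (\<delta> - 1) = g * m" by blast
        then have "x [^] (p ^ (\<delta> - 1)) = (x [^] g) [^] m" using x(1) by (simp only: nat_pow_pow)
        then show False using ne xg by simp
      qed
      then have "i = \<delta>" using i(1) by simp
      then show "int (p ^ \<delta>) dvd n" using gcd_dvd1[of n "int (p ^ \<delta>)"] unfolding g[symmetric] i(2) by simp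
    qed
  qed
  finally show ?thesis .
qed

text \<open>The first entry may be anything of full order \<open>p ^ \<delta>\<close>; each later
  one is taken from the \<open>p\<close>-torsion outside the span so far. The tuple \<open>a\<close>
  serves to determine the exponent and the torsion of \<open>G\<close>.\<close>

lemma (in comm_group) card_indep_tuples:
  assumes p: "prime p" and \<delta>: "\<delta> \<in> {1, 2}"
    and r: "r = (\<lambda>i. if i = 0 then p ^ \<delta> else p)"
    and a: "indep G r (Suc m) a" and order: "card (carrier G) = p ^ (m + \<delta>)"
    and "j \<le> m"
  shows "card (indep_tuples G r (Suc j)) =
    (p ^ (m + \<delta>) - p ^ ((\<delta> - 1) * (m + 1))) * (\<Prod>i = 1..j. p ^ (m + 1) - p ^ i)"
proof -
  have p1: "1 < p" using p by (rule prime_gt_1_nat)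
  have r_pos: "\<forall>i<k. 0 < r i" for k using p1 by (simp add: r)
  have "0 < card (carrier G)" using order p1 by simp
  then have finG: "finite (carrier G)" by (rule card_ge_0_finite)
  have prod_r: "card (carrier G) = (\<Prod>i<Suc m. r i)"
    unfolding order r prod.lessThan_Suc_shift by (simp add: power_add)
  have gen: "range (power_prod G (Suc m) a) = carrier G"
    using a r_pos prod_r by (rule range_power_prod_eq_carrier)
  have r_dvd: "p dvd r i" "r i dvd p ^ \<delta>" for i
    using \<delta> by (auto simp: r)
  \<comment> \<open>Each coordinate contributes one factor \<open>p\<close> to the
    \<open>p\<close>-torsion, also the one of order \<open>p ^ \<delta>\<close>.\<close>
  have gcd_r: "gcd p (r i) = p" for i using r_dvd(1) by (rule gcd_nat.absorb1)
  have tors: "card {x \<in> range (power_prod G k b). x [^] p = \<one>} = p ^ k" if "indep G r k b" for k b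
    using card_torsion_span[OF that r_pos, of p] gcd_r by simp
  have exp: "x [^] (p ^ \<delta>) = \<one>" if x: "x \<in> carrier G" for x
  proof -
    obtain e where e: "x = power_prod G (Suc m) a e" using x gen by auto
    have ac: "\<forall>i<Suc m. a i \<in> carrier G" using a by (rule indep_carrier)
    have "int (r i) dvd int (p ^ \<delta>) * e i" for i
      using r_dvd(2)[of i] by (intro dvd_mult2) (simp only: int_dvd_int_iff)
    then have "x [^] int (p ^ \<delta>) = \<one>"
      unfolding e power_prod_mult[OF ac, symmetric] power_prod_eq_one_iff[OF a] by blast
    then show ?thesis by (simp only: int_pow_int)
  qed
  \<comment> \<open>For \<open>\<delta> = 1\<close> the exponent is \<open>p ^ 0 = 1\<close> and
    only the identity qualifies; for \<open>\<delta> = 2\<close> this is the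
    \<open>p\<close>-torsion of all of \<open>G\<close>.\<close>
  have K: "card {x \<in> carrier G. x [^] (p ^ (\<delta> - 1)) = \<one>} = p ^ ((\<delta> - 1) * (m + 1))"
  proof (cases "\<delta> = 1")
    case True
    have "{x \<in> carrier G. x [^] (1::nat) = \<one>} = {\<one>}" by auto
    then show ?thesis using True by simp
  next
    case False
    then have "\<delta> = 2" using \<delta> by auto
    then show ?thesis using tors[OF a] gen by simp
  qed
  show ?thesis
    using \<open>j \<le> m\<close>
  proof (induction j)
    case 0
    have one: "indep G r (Suc 0) b \<longleftrightarrow> x [^] (p ^ (\<delta> - 1)) \<noteq> \<one>" if "x \<in> carrier G" "b 0 = x" for b x
      using \<delta> by (intro indep_one_iff[OF p that(1) exp[OF that(1)]] that(2)) (auto simp: r)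
    have "bij_betw (\<lambda>x. \<lambda>i\<in>{..<Suc 0}. x) (carrier G - {x \<in> carrier G. x [^] (p ^ (\<delta> - 1)) = \<one>})
      (indep_tuples G r (Suc 0))"
    proof (rule bij_betwI')
      fix x y
      show "((\<lambda>i\<in>{..<Suc 0}. x) = (\<lambda>i\<in>{..<Suc 0}. y)) = (x = y)"
        by (auto dest: fun_cong[of _ _ 0])
    next
      fix x assume "x \<in> carrier G - {x \<in> carrier G. x [^] (p ^ (\<delta> - 1)) = \<one>}"
      then show "(\<lambda>i\<in>{..<Suc 0}. x) \<in> indep_tuples G r (Suc 0)"
        using one[of x "\<lambda>i\<in>{..<Suc 0}. x"] by (simp add: indep_tuples_def)
    next
      fix b assume b: "b \<in> indep_tuples G r (Suc 0)"
      then have "b 0 \<in> carrier G" "indep G r (Suc 0) b" by (auto simp: indep_tuples_def PiE_iff)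
      then have "b 0 \<in> carrier G - {x \<in> carrier G. x [^] (p ^ (\<delta> - 1)) = \<one>}"
        using one[of "b 0" b] by simp
      moreover have "b = (\<lambda>i\<in>{..<Suc 0}. b 0)"
      proof (rule extensionalityI)
        show "b \<in> extensional {..<Suc 0}" using b by (simp add: indep_tuples_def PiE_iff)
      qed auto
      ultimately show "\<exists>x\<in>carrier G - {x \<in> carrier G. x [^] (p ^ (\<delta> - 1)) = \<one>}. b = (\<lambda>i\<in>{..<Suc 0}. x)"
        by blast
    qed
    from bij_betw_same_card[OF this] have "card (indep_tuples G r (Suc 0)) = p ^ (m + \<delta>) - p ^ ((\<delta> - 1) * (m + 1))"
      using finG K order by (subst (asm) card_Diff_subset) auto
    then show ?case by simp
  next
    case (Suc j)
    define T where "T = {x \<in> carrier G. x [^] p = \<one>}"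
    have T: "finite T" "card T = p ^ (m + 1)" using finG tors[OF a] gen by (auto simp: T_def)
    \<comment> \<open>For \<open>\<delta> = 2\<close> the span is not contained in \<open>T\<close>;
      what gets removed is its \<open>p\<close>-torsion, which has \<open>p ^ Suc j\<close>
      elements.\<close>
    have step: "card (T - range (power_prod G (Suc j) b)) = p ^ (m + 1) - p ^ Suc j"
      if "b \<in> indep_tuples G r (Suc j)" for b
    proof -
      have b: "indep G r (Suc j) b" using that by (simp add: indep_tuples_def)
      then have "\<forall>i<Suc j. b i \<in> carrier G" by (rule indep_carrier)
      then have "T \<inter> range (power_prod G (Suc j) b) = {x \<in> range (power_prod G (Suc j) b). x [^] p = \<one>}"
        by (auto simp: T_def)
      moreover have "finite (T \<inter> range (power_prod G (Suc j) b))" using T(1) by simp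
      ultimately show ?thesis using T(2) tors[OF b] by (simp only: card_Diff_subset_Int)
    qed
    have fin: "finite (indep_tuples G r (Suc j))"
      unfolding indep_tuples_def using finG by (intro finite_subset[OF Collect_restrict] finite_PiE) auto
    have "prime (r (Suc j))" using p by (simp add: r)
    from bij_betw_same_card[OF indep_tuples_Suc[of r "Suc j", OF this]]
    have "card (indep_tuples G r (Suc (Suc j))) =
        card (SIGMA b:indep_tuples G r (Suc j). T - range (power_prod G (Suc j) b))"
      by (simp add: T_def r)
    also have "\<dots> = card (indep_tuples G r (Suc j)) * (p ^ (m + 1) - p ^ Suc j)"
      using fin T step by (subst card_SigmaI) auto
    finally show ?case using Suc by (simp add: mult.assoc)
  qed
qed

section \<open>The generators as digit rotations\<close>

lemma carrier_sym_grp [simp]: "f \<in> carrier sym_grp \<longleftrightarrow> bij f"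
  by (simp add: BijGroup_def Bij_def)

lemma mult_sym_grp: "bij f \<Longrightarrow> bij g \<Longrightarrow> f \<otimes>\<^bsub>sym_grp\<^esub> g = f \<circ> g"
  by (simp add: BijGroup_def Bij_def compose_def fun_eq_iff)

lemma one_sym_grp [simp]: "\<one>\<^bsub>sym_grp\<^esub> = id"
  by (simp add: BijGroup_def fun_eq_iff)

lemma pow_sym_grp: "bij f \<Longrightarrow> f [^]\<^bsub>sym_grp\<^esub> (k::nat) = f ^^ k"
  by (induction k) (simp_all add: mult_sym_grp funpow_Suc_right del: funpow.simps(2))

text \<open>What commutes with all generators commutes with everything generated. This is applied
  first to a generator and then to an arbitrary generated element.\<close>

lemma (in group) comm_group_generate:
  assumes S: "S \<subseteq> carrier G" and comm: "\<And>x y. x \<in> S \<Longrightarrow> y \<in> S \<Longrightarrow> x \<otimes> y = y \<otimes> x"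
  shows "comm_group (G\<lparr>carrier := generate G S\<rparr>)"
proof -
  have commute: "x \<otimes> y = y \<otimes> x"
    if x: "x \<in> carrier G" and y: "y \<in> generate G S" and xS: "\<And>s. s \<in> S \<Longrightarrow> x \<otimes> s = s \<otimes> x" for x y
    using y
  proof (induction y rule: generate.induct)
    case one
    then show ?case using x by simp
  next
    case (incl h)
    then show ?case by (rule xS)
  next
    case (inv h)
    then have h: "h \<in> carrier G" using S by blast
    have "inv h \<otimes> (x \<otimes> h) \<otimes> inv h = inv h \<otimes> (h \<otimes> x) \<otimes> inv h" using xS[OF inv] by simp
    then show ?case using x h by (simp add: m_assoc flip: m_assoc[of "inv h" h])
  next
    case (eng h1 h2)
    have h: "h1 \<in> carrier G" "h2 \<in> carrier G"
      using eng.hyps generate_in_carrier[OF S] by blast+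
    have "x \<otimes> (h1 \<otimes> h2) = h1 \<otimes> x \<otimes> h2" using eng.IH(1) x h by (simp flip: m_assoc)
    also have "\<dots> = h1 \<otimes> h2 \<otimes> x" using eng.IH(2) x h by (simp add: m_assoc)
    finally show ?case .
  qed
  have sub: "subgroup (generate G S) G" using S by (rule generate_is_subgroup)
  then interpret H: group "G\<lparr>carrier := generate G S\<rparr>" by (rule subgroup.subgroup_is_group) (rule is_group)
  have gc: "x \<in> carrier G" if "x \<in> generate G S" for x using generate_in_carrier[OF S that] .
  show ?thesis
  proof (rule H.group_comm_groupI)
    fix x y assume "x \<in> carrier (G\<lparr>carrier := generate G S\<rparr>)" "y \<in> carrier (G\<lparr>carrier := generate G S\<rparr>)"
    then have xy: "x \<in> generate G S" "y \<in> generate G S" by simp_all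
    have "x \<otimes> s = s \<otimes> x" if "s \<in> S" for s
      using commute[OF _ xy(1), of s] that S comm by auto
    then show "x \<otimes>\<^bsub>G\<lparr>carrier := generate G S\<rparr>\<^esub> y = y \<otimes>\<^bsub>G\<lparr>carrier := generate G S\<rparr>\<^esub> x"
      using commute[OF gc[OF xy(1)] xy(2)] by simp
  qed
qed

section \<open>Rotating one digit of an index\<close>

text \<open>In a mixed radix expansion of \<open>t\<close>, the digit of weight \<open>w\<close> and
  radix \<open>r\<close> is \<open>t div w mod r\<close>. It is increased by \<open>k\<close> modulo
  \<open>r\<close>, while the higher part \<open>t div w div r\<close> and the lower part
  \<open>t mod w\<close> stay.\<close>

definition shift_digit :: "nat \<Rightarrow> nat \<Rightarrow> nat \<Rightarrow> nat \<Rightarrow> nat" where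
  "shift_digit w r k t = w * (r * (t div w div r) + (t div w + k) mod r) + t mod w"

lemma shift_digit_div: "w > 0 \<Longrightarrow> r > 0 \<Longrightarrow> shift_digit w r k t div w = r * (t div w div r) + (t div w + k) mod r"
  and shift_digit_mod: "w > 0 \<Longrightarrow> shift_digit w r k t mod w = t mod w"
  by (simp_all add: shift_digit_def)

lemma shift_digit_div_mult: "w > 0 \<Longrightarrow> r > 0 \<Longrightarrow> shift_digit w r k t div (w * r) = t div (w * r)"
  by (simp add: div_mult2_eq shift_digit_div)

lemma shift_digit_add:
  assumes "w > 0" "r > 0"
  shows "shift_digit w r k (shift_digit w r l t) = shift_digit w r (l + k) t"
proof -
  have "(shift_digit w r l t div w + k) mod r = (t div w + (l + k)) mod r"
    using assms by (simp add: shift_digit_div mod_simps add.assoc)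
  moreover have "shift_digit w r l t div w div r = t div w div r"
    using assms by (simp add: shift_digit_div)
  ultimately show ?thesis
    using assms unfolding shift_digit_def[of w r k] by (simp add: shift_digit_mod) (simp add: shift_digit_def)
qed

lemma shift_digit_period: "shift_digit w r r t = t"
  by (simp add: shift_digit_def)

text \<open>A shift preserves each block of \<open>w * r\<close> consecutive indices that starts at
  a multiple of \<open>w * r\<close>, and the indices below \<open>q\<close> form a union of such
  blocks.\<close>

lemma shift_digit_less:
  assumes "w > 0" "r > 0" "w * r dvd q" "t < q"
  shows "shift_digit w r k t < q"
proof -
  obtain s where q: "q = w * r * s" using assms(3) by blast
  have "t div (w * r) < s" using assms(4) unfolding q by (intro less_mult_imp_div_less) (simp add: mult.commute)
  then have "shift_digit w r k t div (w * r) < s" using assms(1,2) by (simp add: shift_digit_div_mult)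
  then show ?thesis using assms(1,2) unfolding q by (simp add: div_less_iff_less_mult mult.commute)
qed

lemma shift_digit_local:
  assumes "w > 0" "r > 0"
  shows "shift_digit w r k t = w * r * (t div (w * r)) + shift_digit w r k (t mod (w * r))"
proof -
  have m: "t mod (w * r) div w = t div w mod r" "t mod (w * r) mod w = t mod w"
    using assms by (simp_all add: mod_mult2_eq)
  have "shift_digit w r k (t mod (w * r)) = w * ((t div w + k) mod r) + t mod w"
    unfolding shift_digit_def m by (simp add: mod_simps)
  then show ?thesis unfolding shift_digit_def[of w r k t] div_mult2_eq by (simp add: distrib_left mult.assoc)
qed

text \<open>With \<open>W = w * r\<close>, the first shift changes only the residue modulo
  \<open>W\<close>. The second preserves the residue modulo \<open>w'\<close>, a multiple of
  \<open>W\<close>, and changes only the quotient by \<open>w'\<close>.\<close>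

lemma shift_digit_commute:
  assumes "w > 0" "r > 0" "w' > 0" "r' > 0" "w * r dvd w'"
  shows "shift_digit w r k (shift_digit w' r' k' t) = shift_digit w' r' k' (shift_digit w r k t)"
proof -
  define W where "W = w * r"
  have W: "W > 0" using assms by (simp add: W_def)
  obtain s where w': "w' = W * s" using assms(5) unfolding W_def by blast
  have s: "s > 0" using assms(3) by (simp add: w')
  define f where "f = shift_digit w r k (t mod W)"
  have fW: "f < W" unfolding f_def W_def using assms W by (intro shift_digit_less) (auto simp: W_def)
  \<comment> \<open>The quotient by \<open>w'\<close> after the shift at weight
    \<open>w'\<close>.\<close>
  define D where "D = r' * (t div w' div r') + (t div w' + k') mod r'"
  have loc: "shift_digit w r k u = W * (u div W) + shift_digit w r k (u mod W)" for u
    unfolding W_def using assms(1,2) by (rule shift_digit_local)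
  have t: "t mod w' = W * (t div W mod s) + t mod W" unfolding w' by (rule mod_mult2_eq)
  have s't: "shift_digit w' r' k' t = W * (s * D + t div W mod s) + t mod W"
    unfolding shift_digit_def[of w'] D_def[symmetric] t by (simp add: w' algebra_simps)
  have st: "shift_digit w r k t = W * (t div W) + f" unfolding f_def by (rule loc)
  have "shift_digit w r k t div w' = t div w'" unfolding w' div_mult2_eq st using fW by simp
  moreover have "shift_digit w r k t mod w' = W * (t div W mod s) + f"
    unfolding w' mod_mult2_eq st using fW by simp
  ultimately have "shift_digit w' r' k' (shift_digit w r k t) = w' * D + (W * (t div W mod s) + f)"
    unfolding shift_digit_def[of w'] D_def by simp
  moreover have "shift_digit w r k (shift_digit w' r' k' t) = W * (s * D + t div W mod s) + f"
    unfolding loc[of "shift_digit w' r' k' t"] unfolding s't f_def using W by simp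
  ultimately show ?thesis by (simp add: w' algebra_simps)
qed

section \<open>Products of disjoint cycles\<close>

lemma comp_list_cycles_fixed:
  assumes "\<And>j. j \<in> set js \<Longrightarrow> z \<notin> set (L j)"
  shows "comp_list (map (\<lambda>j. cycle_of_list (L j)) js) z = z"
  using assms by (induction js) (simp_all add: comp_list_def id_outside_supp)

text \<open>Injectivity of \<open>x\<close> in both indices makes the cycles disjoint, so that only
  the \<open>j\<close>-th factor moves \<open>x j k\<close>.\<close>

lemma comp_list_cycles:
  assumes "distinct js" "j \<in> set js" "k < r"
    and inj: "\<And>j j' k k'. j \<in> set js \<Longrightarrow> j' \<in> set js \<Longrightarrow> k < r \<Longrightarrow> k' < r \<Longrightarrow> x j k = x j' k' \<Longrightarrow> j = j' \<and> k = k'"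
  shows "comp_list (map (\<lambda>j. cycle_of_list (map (x j) [0..<r])) js) (x j k) = x j (Suc k mod r)"
  using assms
proof (induction js)
  case (Cons i js)
  have cons: "comp_list (map (\<lambda>j. cycle_of_list (map (x j) [0..<r])) (i # js)) (x j k) =
      cycle_of_list (map (x i) [0..<r]) (comp_list (map (\<lambda>j. cycle_of_list (map (x j) [0..<r])) js) (x j k))"
    by (simp add: comp_list_def)
  show ?case
  proof (cases "j = i")
    case True
    have "comp_list (map (\<lambda>j. cycle_of_list (map (x j) [0..<r])) js) (x j k) = x j k"
    proof (rule comp_list_cycles_fixed)
      fix j' assume j': "j' \<in> set js"
      then have "j' \<noteq> j" using Cons.prems(1) True by auto
      show "x j k \<notin> set (map (x j') [0..<r])"
      proof
        assume "x j k \<in> set (map (x j') [0..<r])"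
        then obtain k' where "k' < r" "x j k = x j' k'" by auto
        then show False using Cons.prems(4)[of j j' k k'] Cons.prems(2,3) j' \<open>j' \<noteq> j\<close> by simp
      qed
    qed
    moreover have "distinct (map (x i) [0..<r])"
      using Cons.prems(4)[of i i] by (simp add: distinct_map inj_on_def)
    \<comment> \<open>A cycle sends its list of entries to the list rotated by one; this is read off
      at position \<open>k\<close>.\<close>
    from cyclic_rotation[OF this, of 1]
    have "map (cycle_of_list (map (x i) [0..<r])) (map (x i) [0..<r]) ! k = rotate 1 (map (x i) [0..<r]) ! k"
      by simp
    then have "cycle_of_list (map (x i) [0..<r]) (x i k) = x i (Suc k mod r)"
      using Cons.prems(3) by (simp add: nth_rotate del: rotate_Suc)
    ultimately show ?thesis using cons True by simp
  next
    case False
    then have j: "j \<in> set js" using Cons.prems(2) by simp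
    have IH: "comp_list (map (\<lambda>j. cycle_of_list (map (x j) [0..<r])) js) (x j k) = x j (Suc k mod r)"
      using Cons.prems(1,3,4) j by (intro Cons.IH) auto
    have "Suc k mod r < r" using Cons.prems(3) by simp
    have "x j (Suc k mod r) \<notin> set (map (x i) [0..<r])"
    proof
      assume "x j (Suc k mod r) \<in> set (map (x i) [0..<r])"
      then obtain k' where "k' < r" "x j (Suc k mod r) = x i k'" by auto
      then show False using Cons.prems(4)[of j i "Suc k mod r" k'] \<open>Suc k mod r < r\<close> j False by simp
    qed
    then show ?thesis unfolding cons IH by (rule id_outside_supp)
  qed
qed simp

lemma bij_comp_list: "(\<And>f. f \<in> set fs \<Longrightarrow> bij f) \<Longrightarrow> bij (comp_list fs)"
proof (induction fs)
  case (Cons f fs)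
  then have "bij f" "bij (comp_list fs)" by auto
  then have "bij (f \<circ> comp_list fs)" by (rule bij_comp[rotated])
  then show ?case by (simp add: comp_list_def comp_def)
qed (simp add: comp_list_def)

lemma bij_cycle_of_list: "bij (cycle_of_list l)"
  by (rule permutes_bij[OF cycle_permutes])

lemma bij_gen: "bij (gen p n \<delta> c i)"
  unfolding gen_def by (auto intro!: bij_comp_list bij_cycle_of_list)

text \<open>The shape into which the guarded list comprehension in \<open>gen\<close>
  unfolds.\<close>

lemma concat_map_if: "concat (map (\<lambda>x. if P x then [f x] else []) xs) = map f (filter P xs)"
  by (induction xs) auto

section \<open>The generators as rotations of digits\<close>

text \<open>Weight and radix of the digit rotated by \<open>gen p n \<delta> c i\<close>: the lowest
  digit has radix \<open>p ^ \<delta>\<close>, and ordinary base \<open>p\<close> digits follow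
  above it.\<close>

definition digit_weight :: "nat \<Rightarrow> nat \<Rightarrow> nat \<Rightarrow> nat" where
  "digit_weight p \<delta> i = (if i = 0 then 1 else p ^ (i + \<delta> - 1))"

definition digit_radix :: "nat \<Rightarrow> nat \<Rightarrow> nat \<Rightarrow> nat" where
  "digit_radix p \<delta> i = (if i = 0 then p ^ \<delta> else p)"

lemma digit_weight_pos: "p > 0 \<Longrightarrow> digit_weight p \<delta> i > 0"
  and digit_radix_pos: "p > 0 \<Longrightarrow> digit_radix p \<delta> i > 0"
  by (auto simp: digit_weight_def digit_radix_def)

text \<open>This product is also the weight of digit \<open>i + 1\<close>.\<close>

lemma digit_weight_radix: "\<delta> > 0 \<Longrightarrow> digit_weight p \<delta> i * digit_radix p \<delta> i = p ^ (i + \<delta>)"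
  by (auto simp: digit_weight_def digit_radix_def simp flip: power_Suc2)

text \<open>Each cycle of the generator runs through the indices that differ only in the digit
  concerned, in the order of that digit.\<close>

lemma gen_apply:
  assumes p: "p > 0" and \<delta>: "0 < \<delta>" "\<delta> \<le> n" and i: "i \<le> n - \<delta>"
    and c: "inj_on c {..<p ^ n}" and t: "t < p ^ n"
  shows "gen p n \<delta> c i (c t) = c (shift_digit (digit_weight p \<delta> i) (digit_radix p \<delta> i) 1 t)"
proof (cases "i = 0")
  case True
  define r where "r = p ^ \<delta>"
  have r: "r > 0" using p by (simp add: r_def)
  have q: "p ^ n = p ^ (n - \<delta>) * r" using \<delta>(2) by (simp add: r_def flip: power_add)
  have less: "j * r + k < p ^ n" if "j < p ^ (n - \<delta>)" "k < r" for j k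
  proof -
    have "j * r + k < Suc j * r" using that by simp
    also have "\<dots> \<le> p ^ (n - \<delta>) * r" using that by (intro mult_le_mono1) simp
    finally show ?thesis using q by simp
  qed
  have "gen p n \<delta> c i = comp_list (map (\<lambda>j. cycle_of_list (map (\<lambda>k. c (j * r + k)) [0..<r])) [0..<p ^ (n - \<delta>)])"
    by (simp add: gen_def True r_def)
  moreover have "comp_list (map (\<lambda>j. cycle_of_list (map (\<lambda>k. c (j * r + k)) [0..<r])) [0..<p ^ (n - \<delta>)])
      (c (t div r * r + t mod r)) = c (t div r * r + Suc (t mod r) mod r)"
  proof (rule comp_list_cycles)
    show "t div r \<in> set [0..<p ^ (n - \<delta>)]"
      using t unfolding q by (simp add: less_mult_imp_div_less)
    show "t mod r < r" using r by simp
    fix j j' k k'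
    assume a: "j \<in> set [0..<p ^ (n - \<delta>)]" "j' \<in> set [0..<p ^ (n - \<delta>)]" "k < r" "k' < r"
      and "c (j * r + k) = c (j' * r + k')"
    then have "j * r + k = j' * r + k'" using less by (intro inj_onD[OF c]) auto
    then have "(j * r + k) div r = (j' * r + k') div r" "(j * r + k) mod r = (j' * r + k') mod r" by simp_all
    then show "j = j' \<and> k = k'" using a r by simp
  qed simp
  ultimately show ?thesis
    by (simp add: True digit_weight_def digit_radix_def shift_digit_def mod_Suc_eq mult.commute flip: r_def)
next
  case False
  define w where "w = p ^ (i + \<delta> - 1)"
  define x where "x = (\<lambda>j k. c (j + k * w))"
  \<comment> \<open>One starting point for each cycle: the indices whose digit of weight
    \<open>w\<close> is 0.\<close>
  define js where "js = filter (\<lambda>j. j mod (w * p) < w) [0..<p ^ n]"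
  have w: "w > 0" using p by (simp add: w_def)
  have wp: "p ^ (i + \<delta>) = w * p" using False by (simp add: w_def flip: power_Suc2)
  have "w * p dvd p ^ n" unfolding wp[symmetric] using i \<delta> by (intro le_imp_power_dvd) simp
  then obtain s where s: "p ^ n = w * p * s" by blast
  \<comment> \<open>Both \<open>j\<close> and \<open>k\<close> can be recovered from
    \<open>j + k * w\<close>, which gives the disjointness of the cycles.\<close>
  have dec: "(j + k * w) div (w * p) = j div (w * p)" "(j + k * w) mod w = j mod (w * p)"
      "(j + k * w) div w mod p = k" if "j mod (w * p) < w" "k < p" for j k
  proof -
    define u v where "u = j div (w * p)" and "v = j mod (w * p)"
    then have j: "j = w * p * u + v" "v < w" "u = j div (w * p)" "v = j mod (w * p)" using that(1) by simp_all
    have jk: "j + k * w = w * (p * u + k) + v" by (simp add: j(1) algebra_simps)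
    have "(j + k * w) div w = p * u + k" unfolding jk using j(2) by simp
    then show "(j + k * w) div (w * p) = j div (w * p)" "(j + k * w) div w mod p = k"
      using that(2) j(3) by (simp_all add: div_mult2_eq)
    show "(j + k * w) mod w = j mod (w * p)" unfolding jk using j(2,4) by simp
  qed
  have less: "j + k * w < p ^ n" if "j mod (w * p) < w" "k < p" "j < p ^ n" for j k
  proof -
    have "j div (w * p) < s" using that(3) unfolding s by (intro less_mult_imp_div_less) (simp add: mult.commute)
    then have "(j + k * w) div (w * p) < s" using dec(1)[OF that(1,2)] by simp
    then show ?thesis unfolding s using w p by (simp add: div_less_iff_less_mult mult.commute)
  qed
  \<comment> \<open>\<open>j\<close> is \<open>t\<close> with its digit of weight \<open>w\<close>
    set to 0, and \<open>k\<close> is that digit.\<close>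
  define j where "j = w * p * (t div (w * p)) + t mod w"
  define k where "k = t div w mod p"
  have k: "k < p" using p by (simp add: k_def)
  have tmw: "t mod w < w * p"
  proof -
    have "t mod w < w" using w by simp
    also have "w \<le> w * p" using p by simp
    finally show ?thesis .
  qed
  have tjk: "t = j + k * w"
  proof -
    have "t = w * p * (t div (w * p)) + t mod (w * p)" by simp
    also have "t mod (w * p) = w * (t div w mod p) + t mod w" by (rule mod_mult2_eq)
    finally show ?thesis by (simp add: j_def k_def algebra_simps)
  qed
  have "j mod (w * p) = t mod w" using tmw by (simp add: j_def)
  then have j: "j mod (w * p) < w" using w by simp
  have "j < p ^ n" using tjk t by linarith
  then have jjs: "j \<in> set js" using j by (simp add: js_def)
  have "gen p n \<delta> c i = comp_list (map (\<lambda>j. cycle_of_list (map (x j) [0..<p])) js)"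
    using False unfolding gen_def by (simp add: js_def x_def wp w_def concat_map_if)
  moreover have "comp_list (map (\<lambda>j. cycle_of_list (map (x j) [0..<p])) js) (x j k) = x j (Suc k mod p)"
  proof (rule comp_list_cycles)
    show "distinct js" by (simp add: js_def)
    fix j j' k k'
    assume "j \<in> set js" "j' \<in> set js" and k: "k < p" "k' < p" and "x j k = x j' k'"
    then have j: "j < p ^ n" "j mod (w * p) < w" "j' < p ^ n" "j' mod (w * p) < w" by (auto simp: js_def)
    have eq: "j + k * w = j' + k' * w"
      using \<open>x j k = x j' k'\<close> less j k unfolding x_def by (intro inj_onD[OF c]) auto
    then have "j div (w * p) = j' div (w * p)" "j mod (w * p) = j' mod (w * p)" "k = k'"
      using dec[OF j(2) k(1)] dec[OF j(4) k(2)] by simp_all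
    then show "j = j' \<and> k = k'" by (metis div_mult_mod_eq)
  qed (fact jjs k)+
  moreover have "shift_digit w p 1 t = j + Suc k mod p * w"
    unfolding shift_digit_def j_def k_def div_mult2_eq by (simp add: mod_Suc_eq algebra_simps)
  moreover have "digit_weight p \<delta> i = w" "digit_radix p \<delta> i = p"
    using False by (simp_all add: digit_weight_def digit_radix_def w_def)
  ultimately show ?thesis using tjk by (simp add: x_def)
qed

lemma gen_funpow_apply:
  assumes p: "p > 0" and \<delta>: "0 < \<delta>" "\<delta> \<le> n" and i: "i \<le> n - \<delta>"
    and c: "inj_on c {..<p ^ n}" and t: "t < p ^ n"
  shows "(gen p n \<delta> c i ^^ k) (c t) = c (shift_digit (digit_weight p \<delta> i) (digit_radix p \<delta> i) k t)"
proof (induction k)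
  case 0
  then show ?case by (simp add: shift_digit_def)
next
  case (Suc k)
  have pos: "digit_weight p \<delta> i > 0" "digit_radix p \<delta> i > 0"
    using p by (simp_all add: digit_weight_pos digit_radix_pos)
  have "digit_weight p \<delta> i * digit_radix p \<delta> i dvd p ^ n"
    unfolding digit_weight_radix[OF \<delta>(1)] using i \<delta> by (intro le_imp_power_dvd) simp
  from shift_digit_less[OF pos this t]
  show ?case using gen_apply[OF p \<delta> i c] by (simp add: Suc shift_digit_add[OF pos])
qed

section \<open>Commutation and independence of the generators\<close>

context
  fixes p n \<delta> :: nat and c :: "nat \<Rightarrow> 'a"
  assumes p: "p > 0" and \<delta>: "0 < \<delta>" "\<delta> \<le> n" and c: "bij_betw c {..<p ^ n} (UNIV :: 'a set)"
begin

lemma ex_index: "\<exists>t<p ^ n. x = c t"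
proof -
  have "x \<in> c ` {..<p ^ n}" using c by (simp add: bij_betw_def)
  then show ?thesis by auto
qed

lemma inj_on_listing: "inj_on c {..<p ^ n}"
  using c by (simp add: bij_betw_def)

lemma gen_funpow_radix:
  assumes "i \<le> n - \<delta>"
  shows "gen p n \<delta> c i ^^ digit_radix p \<delta> i = id"
proof
  fix x
  obtain t where t: "t < p ^ n" "x = c t" using ex_index by blast
  then show "(gen p n \<delta> c i ^^ digit_radix p \<delta> i) x = id x"
    using gen_funpow_apply[OF p \<delta> assms inj_on_listing t(1)] by (simp add: shift_digit_period)
qed

text \<open>Two different generators rotate different digits; for \<open>i < j\<close> the digit
  \<open>i\<close> lies wholly below the weight of digit \<open>j\<close>.\<close>

lemma gen_commute:
  assumes "i \<le> n - \<delta>" "j \<le> n - \<delta>"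
  shows "gen p n \<delta> c i \<circ> gen p n \<delta> c j = gen p n \<delta> c j \<circ> gen p n \<delta> c i"
  using assms
proof (induction i j rule: linorder_wlog)
  case (le i j)
  show ?case
  proof (cases "i = j")
    case False
    then have ij: "i < j" using le by simp
    let ?w = "digit_weight p \<delta>" and ?r = "digit_radix p \<delta>"
    have pos: "?w k > 0" "?r k > 0" for k
      using p by (simp_all add: digit_weight_pos digit_radix_pos)
    have dvd: "?w k * ?r k dvd p ^ n" if "k \<le> n - \<delta>" for k
      unfolding digit_weight_radix[OF \<delta>(1)] using that \<delta> by (intro le_imp_power_dvd) simp
    have dvd': "?w i * ?r i dvd ?w j"
      unfolding digit_weight_radix[OF \<delta>(1)] using ij by (simp add: digit_weight_def le_imp_power_dvd)
    show ?thesis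
    proof
      fix x
      obtain t where t: "t < p ^ n" "x = c t" using ex_index by blast
      have "gen p n \<delta> c k (gen p n \<delta> c l (c t)) = c (shift_digit (?w k) (?r k) 1 (shift_digit (?w l) (?r l) 1 t))"
        if "k \<le> n - \<delta>" "l \<le> n - \<delta>" for k l
        using gen_apply[OF p \<delta> that(2) inj_on_listing t(1)]
          gen_apply[OF p \<delta> that(1) inj_on_listing shift_digit_less[OF pos dvd[OF that(2)] t(1)]] by simp
      then show "(gen p n \<delta> c i \<circ> gen p n \<delta> c j) x = (gen p n \<delta> c j \<circ> gen p n \<delta> c i) x"
        using le.prems t(2) shift_digit_commute[OF pos pos dvd'] by simp
    qed
  qed simp
qed (rule sym)

lemma comm_group_G_set: "comm_group (sym_grp\<lparr>carrier := G_set p n \<delta> c\<rparr>)"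
  unfolding G_set_def
proof (rule group.comm_group_generate[OF group_BijGroup])
  fix x y assume "x \<in> gen p n \<delta> c ` {0..n - \<delta>}" "y \<in> gen p n \<delta> c ` {0..n - \<delta>}"
  then show "x \<otimes>\<^bsub>sym_grp\<^esub> y = y \<otimes>\<^bsub>sym_grp\<^esub> x"
    by (auto simp: mult_sym_grp bij_gen intro: gen_commute)
qed (auto simp: bij_gen)

text \<open>Since the generators commute, the generated group consists of their power products. Its
  order equals the product \<open>p ^ \<delta> * p ^ (n - \<delta>)\<close> of the radices, so
  \<open>indep_if_generating\<close> applies.\<close>

lemma indep_gen:
  assumes "card (G_set p n \<delta> c) = p ^ n"
  shows "indep (sym_grp\<lparr>carrier := G_set p n \<delta> c\<rparr>) (digit_radix p \<delta>) (Suc (n - \<delta>)) (gen p n \<delta> c)"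
proof -
  let ?S = "gen p n \<delta> c ` {0..n - \<delta>}" and ?r = "digit_radix p \<delta>" and ?k = "Suc (n - \<delta>)"
  define G where "G = sym_grp\<lparr>carrier := G_set p n \<delta> c\<rparr>"
  interpret comm_group G unfolding G_def by (rule comm_group_G_set)
  have S: "?S \<subseteq> carrier sym_grp" by (auto simp: bij_gen)
  have sub: "subgroup (G_set p n \<delta> c) sym_grp"
    unfolding G_set_def using group.generate_is_subgroup[OF group_BijGroup S] .
  have gen: "\<forall>i<?k. gen p n \<delta> c i \<in> carrier G \<and> gen p n \<delta> c i [^]\<^bsub>G\<^esub> ?r i = \<one>\<^bsub>G\<^esub>"
  proof (intro allI impI)
    fix i assume i: "i < ?k"
    then have "gen p n \<delta> c i \<in> carrier G"
      by (auto simp: G_def G_set_def intro!: generate.incl)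
    moreover have "gen p n \<delta> c i [^]\<^bsub>G\<^esub> ?r i = gen p n \<delta> c i [^]\<^bsub>sym_grp\<^esub> ?r i"
      unfolding G_def by (rule monoid.nat_pow_consistent[symmetric, OF group.is_monoid[OF group_BijGroup]])
    then have "gen p n \<delta> c i [^]\<^bsub>G\<^esub> ?r i = \<one>\<^bsub>G\<^esub>"
      using i gen_funpow_radix[of i] by (simp add: pow_sym_grp bij_gen G_def)
    ultimately show "gen p n \<delta> c i \<in> carrier G \<and> gen p n \<delta> c i [^]\<^bsub>G\<^esub> ?r i = \<one>\<^bsub>G\<^esub>" ..
  qed
  then have genc: "\<forall>i<?k. gen p n \<delta> c i \<in> carrier G" by blast
  have unit: "\<exists>e. gen p n \<delta> c i [^]\<^bsub>G\<^esub> m = power_prod G ?k (gen p n \<delta> c) e" if "i < ?k" for i and m :: int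
    using power_prod_unit[OF genc that, of m] by metis
  have "\<exists>e. x = power_prod G ?k (gen p n \<delta> c) e" if "x \<in> generate sym_grp ?S" for x
    using that
  proof (induction x rule: generate.induct)
    case one
    have "\<one>\<^bsub>G\<^esub> = power_prod G ?k (gen p n \<delta> c) (\<lambda>_. 0)" using power_prod_eq_one[OF gen, of "\<lambda>_. 0"] by simp
    then have "\<one>\<^bsub>sym_grp\<^esub> = power_prod G ?k (gen p n \<delta> c) (\<lambda>_. 0)" by (simp add: G_def del: one_sym_grp)
    then show ?case by blast
  next
    case (incl h)
    then obtain i where "i \<in> {0..n - \<delta>}" and h: "h = gen p n \<delta> c i" by blast
    then have i: "i < ?k" by simp
    then show ?case using unit[OF i, of 1] genc h by auto
  next
    case (inv h)
    then obtain i where "i \<in> {0..n - \<delta>}" and h: "h = gen p n \<delta> c i" by blast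
    then have i: "i < ?k" by simp
    have "inv\<^bsub>sym_grp\<^esub> h = inv\<^bsub>G\<^esub> h"
      unfolding G_def using genc i h by (intro group.m_inv_consistent[OF group_BijGroup sub, symmetric]) (auto simp: G_def)
    also have "\<dots> = gen p n \<delta> c i [^]\<^bsub>G\<^esub> (-1 :: int)" using genc i h by (simp add: int_pow_neg)
    finally show ?case using unit[OF i, of "-1"] by simp
  next
    case (eng h1 h2)
    then obtain e e' where "h1 = power_prod G ?k (gen p n \<delta> c) e" "h2 = power_prod G ?k (gen p n \<delta> c) e'" by blast
    then have "h1 \<otimes>\<^bsub>G\<^esub> h2 = power_prod G ?k (gen p n \<delta> c) (\<lambda>i. e i + e' i)" using power_prod_add[OF genc] by simp
    then show ?case by (auto simp: G_def)
  qed
  then have "carrier G \<subseteq> range (power_prod G ?k (gen p n \<delta> c))" by (auto simp: G_def G_set_def)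
  moreover have "card (carrier G) = (\<Prod>i<?k. ?r i)"
    using assms \<delta> unfolding prod.lessThan_Suc_shift by (simp add: G_def digit_radix_def flip: power_add)
  ultimately show ?thesis
    unfolding G_def[symmetric] using gen p by (intro indep_if_generating) (simp_all add: digit_radix_pos)
qed

end

section \<open>Local permutation polynomials as tuples of permutations\<close>

definition lagrange_basis :: "'a::{finite,field} \<Rightarrow> 'a poly" where
  "lagrange_basis a = (\<Prod>b\<in>UNIV - {a}. smult (inverse (a - b)) [:- b, 1:])"

definition interpolant :: "('a::{finite,field} \<Rightarrow> 'a) \<Rightarrow> 'a poly" where
  "interpolant h = (\<Sum>a\<in>UNIV. smult (h a) (lagrange_basis a))"

lemma poly_lagrange_basis: "poly (lagrange_basis a) x = (if x = a then 1 else 0)"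
proof (cases "x = a")
  case True
  have "poly (smult (inverse (a - b)) [:- b, 1:]) a = 1" if "b \<noteq> a" for b
  proof -
    have "poly (smult (inverse (a - b)) [:- b, 1:]) a = inverse (a - b) * (a - b)"
      by (simp add: algebra_simps)
    then show ?thesis using that by simp
  qed
  then have "poly (lagrange_basis a) a = 1"
    unfolding lagrange_basis_def poly_prod by (intro prod.neutral) blast
  then show ?thesis using True by simp
next
  case False
  then show ?thesis
    by (auto simp: lagrange_basis_def poly_prod intro!: prod_zero)
qed

lemma degree_lagrange_basis: "degree (lagrange_basis (a :: 'a::{finite,field})) < CARD('a)"
proof -
  have "degree (lagrange_basis a) \<le> (\<Sum>b\<in>UNIV - {a}. degree (smult (inverse (a - b)) [:- b, 1:]))"
    unfolding lagrange_basis_def by (rule order_trans[OF degree_prod_sum_le]) (simp_all add: o_def)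
  also have "\<dots> \<le> (\<Sum>b\<in>UNIV - {a}. 1)" by (intro sum_mono) simp
  also have "\<dots> = CARD('a) - 1" by (simp add: card_Diff_subset)
  finally show ?thesis using zero_less_card_finite[where 'a = 'a] by linarith
qed

lemma poly_interpolant [simp]: "poly (interpolant h) x = h x"
  by (simp add: interpolant_def poly_sum poly_lagrange_basis if_distrib cong: if_cong)

lemma degree_interpolant: "degree (interpolant (h :: 'a::{finite,field} \<Rightarrow> 'a)) < CARD('a)"
  unfolding interpolant_def
  by (rule degree_sum_less) (simp_all add: degree_lagrange_basis)

lemma poly_eqI_CARD:
  fixes p q :: "'a::{finite,field} poly"
  assumes "degree p < CARD('a)" "degree q < CARD('a)" "\<And>x. poly p x = poly q x"
  shows "p = q"
  using assms by (intro poly_eqI_degree[of UNIV]) auto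

lemma coeff_subst_fst: "coeff (subst_fst f x) k = poly (coeff f k) x"
  by (simp add: subst_fst_def coeff_map_poly)

text \<open>Uniqueness of interpolation is used twice: in the second variable for each fixed
  \<open>x\<close>, then for each coefficient as a polynomial in the first variable.\<close>

lemma eval2_unique:
  fixes f g :: "'a::{finite,field} poly poly"
  assumes f: "reduced_poly2 f" and g: "reduced_poly2 g" and eq: "\<And>x y. eval2 f x y = eval2 g x y"
  shows "f = g"
proof (rule poly_eqI)
  fix k
  have deg: "degree (subst_fst f x) < CARD('a)" if "reduced_poly2 f" for f :: "'a poly poly" and x
  proof -
    have "degree (subst_fst f x) \<le> degree f"
      by (rule degree_le) (simp add: coeff_subst_fst coeff_eq_0)
    then show ?thesis using that by (simp add: reduced_poly2_def)
  qed
  have "subst_fst f x = subst_fst g x" for x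
    using eq by (intro poly_eqI_CARD deg f g) (simp add: eval2_def)
  then have "poly (coeff f k) x = poly (coeff g k) x" for x by (simp flip: coeff_subst_fst)
  then show "coeff f k = coeff g k"
    using f g by (intro poly_eqI_CARD) (auto simp: reduced_poly2_def)
qed

text \<open>Interpolate \<open>h x\<close> in the second variable for each \<open>x\<close>, then
  interpolate each resulting coefficient as a function of \<open>x\<close>.\<close>

lemma eval2_ex:
  fixes h :: "'a::{finite,field} \<Rightarrow> 'a \<Rightarrow> 'a"
  shows "\<exists>f. reduced_poly2 f \<and> eval2 f = h"
proof -
  define f where "f = (\<Sum>k<CARD('a). monom (interpolant (\<lambda>x. coeff (interpolant (h x)) k)) k)"
  have cf: "coeff f k = (if k < CARD('a) then interpolant (\<lambda>x. coeff (interpolant (h x)) k) else 0)" for k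
    by (simp add: f_def coeff_sum)
  have "subst_fst f x = interpolant (h x)" for x
  proof (rule poly_eqI)
    fix k
    show "coeff (subst_fst f x) k = coeff (interpolant (h x)) k"
      using degree_interpolant[of "h x"] by (simp add: coeff_subst_fst cf coeff_eq_0)
  qed
  then have "eval2 f = h" by (simp add: eval2_def fun_eq_iff)
  moreover have "degree f < CARD('a)"
    unfolding f_def by (rule degree_sum_less) (auto intro: le_less_trans[OF degree_monom_le])
  then have "reduced_poly2 f" by (auto simp: reduced_poly2_def cf degree_interpolant)
  ultimately show ?thesis by blast
qed

section \<open>Simply transitive sets and their orderings\<close>

text \<open>Stated for sets of maps, as it also expresses the tuple condition: for a set of
  \<open>q\<close> permutations of a \<open>q\<close>-element set it says that no quotient of two
  different members has a fixed point.\<close>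

definition simply_transitive :: "('a \<Rightarrow> 'a) set \<Rightarrow> bool" where
  "simply_transitive H \<longleftrightarrow> (\<forall>x y. \<exists>!h. h \<in> H \<and> h x = y)"

text \<open>Evaluation at any one point is a bijection from \<open>H\<close> to the type.\<close>

lemma card_simply_transitive:
  fixes H :: "('a::finite \<Rightarrow> 'a) set"
  assumes "simply_transitive H"
  shows "card H = CARD('a)"
proof -
  fix x :: 'a
  have "bij_betw (\<lambda>h. h x) H UNIV"
    using assms by (intro bij_betwI') (auto simp: simply_transitive_def, metis+)
  then show ?thesis by (rule bij_betw_same_card)
qed

lemma card_bijections:
  assumes "finite A" "finite B" "card A = card B"
  shows "card {b \<in> A \<rightarrow>\<^sub>E B. bij_betw b A B} = fact (card A)"
proof -
  have "bij_betw b A B \<longleftrightarrow> inj_on b A" if "b \<in> A \<rightarrow>\<^sub>E B" for b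
  proof
    assume "inj_on b A"
    moreover have "b ` A \<subseteq> B" using that by auto
    ultimately show "bij_betw b A B"
      using assms by (simp add: bij_betw_def card_image card_subset_eq)
  qed (simp add: bij_betw_def)
  then have "{b \<in> A \<rightarrow>\<^sub>E B. bij_betw b A B} = {b \<in> A \<rightarrow>\<^sub>E B. inj_on b A}" by blast
  also have "card \<dots> = fact (card A)"
    using card_inj_on_subset_funcset[OF assms(1,2) subset_refl] assms(3) by (simp add: fact_prod_rev)
  finally show ?thesis .
qed

context
  fixes c :: "nat \<Rightarrow> 'a::{finite,field}"
  assumes c: "bij_betw c {..<CARD('a)} UNIV"
begin

lemma listing_ex1: "\<exists>!i. i < CARD('a) \<and> c i = a"
  using c by (auto simp: bij_betw_def inj_on_def) (metis UNIV_I imageE lessThan_iff)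

text \<open>The member carrying \<open>x\<close> to \<open>y\<close> has as its index the position
  of \<open>eval2 f x y\<close> in the listing.\<close>

lemma simply_transitive_assoc_set:
  assumes f: "local_perm_poly f"
  shows "simply_transitive (assoc_set c f)"
  unfolding simply_transitive_def
proof (intro allI)
  fix x y
  obtain i where i: "i < CARD('a)" "c i = eval2 f x y" using listing_ex1 by metis
  show "\<exists>!h. h \<in> assoc_set c f \<and> h x = y"
  proof (rule ex1I)
    show "beta c f i \<in> assoc_set c f \<and> beta c f i x = y"
      using i beta_unique[OF f, of x y c i] by (simp add: assoc_set_def)
    fix h assume h: "h \<in> assoc_set c f \<and> h x = y"
    then obtain j where j: "j < CARD('a)" "h = beta c f j" by (auto simp: assoc_set_def)
    then have "c j = eval2 f x y" using h eval2_beta[OF f, of x c j] by simp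
    then have "j = i" using i j listing_ex1 by metis
    then show "h = beta c f i" using j by simp
  qed
qed

lemma inj_on_beta:
  assumes "local_perm_poly f"
  shows "inj_on (beta c f) {..<CARD('a)}"
proof (rule eq_card_imp_inj_on)
  show "card (beta c f ` {..<CARD('a)}) = card {..<CARD('a)}"
    using card_simply_transitive[OF simply_transitive_assoc_set[OF assms]] by (simp add: assoc_set_def)
qed simp

lemma local_perm_poly_eqI:
  assumes f: "local_perm_poly f" and g: "local_perm_poly g"
    and eq: "\<And>i. i < CARD('a) \<Longrightarrow> beta c f i = beta c g i"
  shows "f = g"
proof (rule eval2_unique)
  show "reduced_poly2 f" "reduced_poly2 g" using f g by (simp_all add: local_perm_poly_def)
  fix x y
  obtain i where i: "i < CARD('a)" "c i = eval2 f x y" using listing_ex1 by metis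
  then have "beta c f i x = y" using beta_unique[OF f, of x y c i] by simp
  then show "eval2 f x y = eval2 g x y" using eval2_beta[OF g, of x c i] i eq by simp
qed

text \<open>Let \<open>f\<close> take at \<open>(x, y)\<close> the value \<open>c i\<close>, where
  \<open>b i\<close> is the member carrying \<open>x\<close> to \<open>y\<close>. For fixed
  \<open>x\<close> the index determines \<open>y = b i x\<close>; for fixed \<open>y\<close> it
  determines \<open>x\<close> because \<open>b i\<close> is injective.\<close>

lemma local_perm_poly_ex:
  assumes H: "simply_transitive H" and bij: "\<And>h. h \<in> H \<Longrightarrow> bij h"
    and b: "bij_betw b {..<CARD('a)} H"
  shows "\<exists>f. local_perm_poly f \<and> (\<forall>i<CARD('a). beta c f i = b i)"
proof -
  have ex1: "\<exists>!i. i < CARD('a) \<and> b i x = y" for x y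
  proof -
    obtain h where h: "h \<in> H" "h x = y" "\<And>h'. h' \<in> H \<Longrightarrow> h' x = y \<Longrightarrow> h' = h"
      using H unfolding simply_transitive_def by metis
    have "h \<in> b ` {..<CARD('a)}" using h(1) b by (simp add: bij_betw_def)
    then obtain i where i: "i < CARD('a)" "h = b i" by auto
    show ?thesis
    proof (rule ex1I)
      show "i < CARD('a) \<and> b i x = y" using i h(2) by simp
      fix j assume j: "j < CARD('a) \<and> b j x = y"
      have "b j \<in> H" using j bij_betwE[OF b] by blast
      then have "b j = b i" using h(3)[of "b j"] i(2) j by simp
      then show "j = i" using i(1) j by (intro inj_onD[OF bij_betw_imp_inj_on[OF b]]) simp_all
    qed
  qed
  define \<iota> where "\<iota> x y = (THE i. i < CARD('a) \<and> b i x = y)" for x y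
  have \<iota>: "\<iota> x y < CARD('a)" "b (\<iota> x y) x = y" for x y
    using theI'[OF ex1, of x y] by (simp_all add: \<iota>_def)
  have \<iota>_eq: "\<iota> x (b i x) = i" if "i < CARD('a)" for x i
    unfolding \<iota>_def using that ex1 by (intro the1_equality) auto
  obtain f where red: "reduced_poly2 f" and f: "eval2 f = (\<lambda>x y. c (\<iota> x y))" using eval2_ex by blast
  have c_inj: "\<iota> x y = \<iota> x' y'" if "c (\<iota> x y) = c (\<iota> x' y')" for x y x' y'
    using that \<iota>(1) by (intro inj_onD[OF bij_betw_imp_inj_on[OF c]]) simp_all
  have "perm_poly (subst_fst f x)" for x
  proof -
    have "poly (subst_fst f x) = (\<lambda>y. c (\<iota> x y))" using f by (simp add: eval2_def fun_eq_iff)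
    moreover have "inj (\<lambda>y. c (\<iota> x y))" by (rule injI) (metis c_inj \<iota>(2))
    ultimately show ?thesis unfolding perm_poly_def by (simp add: finite_UNIV_inj_surj bij_def)
  qed
  moreover have "perm_poly (subst_snd f y)" for y
  proof -
    have "poly (subst_snd f y) = (\<lambda>x. c (\<iota> x y))" using f by (simp add: poly_subst_snd fun_eq_iff)
    moreover have "inj (\<lambda>x. c (\<iota> x y))"
    proof (rule injI)
      fix x x' assume "c (\<iota> x y) = c (\<iota> x' y)"
      then have "\<iota> x y = \<iota> x' y" by (rule c_inj)
      then have "b (\<iota> x y) x = b (\<iota> x y) x'" using \<iota>(2)[of x y] \<iota>(2)[of x' y] by simp
      moreover have "bij (b (\<iota> x y))" using bij bij_betwE[OF b] \<iota>(1) by blast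
      ultimately show "x = x'" by (simp add: bij_def inj_eq)
    qed
    ultimately show ?thesis unfolding perm_poly_def by (simp add: finite_UNIV_inj_surj bij_def)
  qed
  ultimately have lpp: "local_perm_poly f" using red by (simp add: local_perm_poly_def)
  moreover have "beta c f i = b i" if "i < CARD('a)" for i
    using beta_unique[OF lpp] f \<iota>_eq[OF that] by (simp add: fun_eq_iff)
  ultimately show ?thesis by blast
qed

text \<open>The polynomials with associated set \<open>H\<close> correspond to the orderings of
  \<open>H\<close>, which has as many elements as the field.\<close>

lemma card_local_perm_poly_assoc_set:
  assumes H: "simply_transitive H" and bij: "\<And>h. h \<in> H \<Longrightarrow> bij h"
  shows "card {f. local_perm_poly f \<and> assoc_set c f = H} = fact (CARD('a))"
proof -
  have "bij_betw (\<lambda>f. restrict (beta c f) {..<CARD('a)}) {f. local_perm_poly f \<and> assoc_set c f = H}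
    {b \<in> {..<CARD('a)} \<rightarrow>\<^sub>E H. bij_betw b {..<CARD('a)} H}"
  proof (rule bij_betwI')
    fix f g assume fg: "f \<in> {f. local_perm_poly f \<and> assoc_set c f = H}" "g \<in> {f. local_perm_poly f \<and> assoc_set c f = H}"
    have "f = g" if eq: "restrict (beta c f) {..<CARD('a)} = restrict (beta c g) {..<CARD('a)}"
    proof (rule local_perm_poly_eqI)
      fix i assume "i < CARD('a)"
      then show "beta c f i = beta c g i" using fun_cong[OF eq, of i] by simp
    qed (use fg in simp_all)
    then show "(restrict (beta c f) {..<CARD('a)} = restrict (beta c g) {..<CARD('a)}) = (f = g)" by blast
  next
    fix f assume "f \<in> {f. local_perm_poly f \<and> assoc_set c f = H}"
    then have f: "local_perm_poly f" "beta c f ` {..<CARD('a)} = H" by (simp_all add: assoc_set_def)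
    then show "restrict (beta c f) {..<CARD('a)} \<in> {b \<in> {..<CARD('a)} \<rightarrow>\<^sub>E H. bij_betw b {..<CARD('a)} H}"
      using inj_on_beta[OF f(1)] by (auto simp: bij_betw_def inj_on_restrict_eq)
  next
    fix b assume "b \<in> {b \<in> {..<CARD('a)} \<rightarrow>\<^sub>E H. bij_betw b {..<CARD('a)} H}"
    then have b: "b \<in> {..<CARD('a)} \<rightarrow>\<^sub>E H" "bij_betw b {..<CARD('a)} H" by simp_all
    obtain f where f: "local_perm_poly f" "\<And>i. i < CARD('a) \<Longrightarrow> beta c f i = b i"
      using local_perm_poly_ex[OF H bij b(2)] by blast
    have "assoc_set c f = b ` {..<CARD('a)}" using f(2) by (simp add: assoc_set_def)
    then have "assoc_set c f = H" using b(2) by (simp add: bij_betw_def)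
    moreover have "b = restrict (beta c f) {..<CARD('a)}"
    proof (rule extensionalityI)
      show "b \<in> extensional {..<CARD('a)}" using b(1) by (simp add: PiE_iff)
    qed (use f(2) in auto)
    ultimately show "\<exists>f\<in>{f. local_perm_poly f \<and> assoc_set c f = H}. b = restrict (beta c f) {..<CARD('a)}"
      using f(1) by blast
  qed
  from bij_betw_same_card[OF this] show ?thesis
    using card_bijections[of "{..<CARD('a)}" H] finite[of H] card_simply_transitive[OF H] by simp
qed

end

section \<open>Simply transitive copies of a group\<close>

definition regular_homs :: "('g, 'm) monoid_scheme \<Rightarrow> ('g \<Rightarrow> 'a \<Rightarrow> 'a) set" where
  "regular_homs G = {h \<in> hom G sym_grp \<inter> extensional (carrier G).
     \<forall>x y. \<exists>!g. g \<in> carrier G \<and> h g x = y}"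

lemma hom_sym_grp_mult:
  assumes "h \<in> hom G sym_grp" "g \<in> carrier G" "k \<in> carrier G"
  shows "h (g \<otimes>\<^bsub>G\<^esub> k) x = h g (h k x)"
proof -
  have "bij (h g)" "bij (h k)" using assms hom_in_carrier[OF assms(1)] by simp_all
  then show ?thesis using hom_mult[OF assms] by (simp add: mult_sym_grp)
qed

text \<open>
  A regular action of \<open>G\<close> together with a base point amounts to a bijection from \<open>G\<close> to the set
  acted on.
\<close>

lemma card_regular_homs:
  fixes G :: "('g, 'm) monoid_scheme"
  assumes G: "group G" and card: "card (carrier G) = CARD('a::finite)"
  shows "CARD('a) * card (regular_homs G :: ('g \<Rightarrow> 'a \<Rightarrow> 'a) set) = fact (CARD('a))"
proof -
  interpret G: group G by fact
  let ?R = "regular_homs G :: ('g \<Rightarrow> 'a \<Rightarrow> 'a) set"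
  let ?B = "{b \<in> carrier G \<rightarrow>\<^sub>E (UNIV :: 'a set). bij_betw b (carrier G) UNIV}"
  have homR: "h \<in> hom G sym_grp" and extR: "h \<in> extensional (carrier G)"
    and exR: "\<exists>!g. g \<in> carrier G \<and> h g x = y" if "h \<in> ?R" for h x y
    using that by (auto simp: regular_homs_def)
  have oneR: "h \<one>\<^bsub>G\<^esub> x = x" if "h \<in> ?R" for h x
    using hom_one[OF homR[OF that] G group_BijGroup] by simp
  have finG: "finite (carrier G)" using card by (intro card_ge_0_finite) simp
  have "bij_betw (\<lambda>(h, x). \<lambda>g\<in>carrier G. h g x) (?R \<times> UNIV) ?B"
  proof (rule bij_betwI')
    fix u v assume "u \<in> ?R \<times> (UNIV :: 'a set)" "v \<in> ?R \<times> (UNIV :: 'a set)"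
    then obtain h x h' x' where uv: "u = (h, x)" "v = (h', x')" and h: "h \<in> ?R" "h' \<in> ?R" by blast
    have "u = v" if eq: "(\<lambda>g\<in>carrier G. h g x) = (\<lambda>g\<in>carrier G. h' g x')"
    proof -
      have eq': "h g x = h' g x'" if "g \<in> carrier G" for g using fun_cong[OF eq, of g] that by simp
      \<comment> \<open>The base point is the value at the identity.\<close>
      have x: "x = x'" using eq'[of "\<one>\<^bsub>G\<^esub>"] oneR[OF h(1)] oneR[OF h(2)] by simp
      have "h = h'"
      proof (rule extensionalityI[OF extR[OF h(1)] extR[OF h(2)]])
        fix g assume g: "g \<in> carrier G"
        show "h g = h' g"
        proof
          fix y
          \<comment> \<open>Every point is reached from the base point, so the orbit map determines
            \<open>h g\<close> through \<open>h g y = h (g \<otimes> k) x\<close>.\<close>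
          obtain k where k: "k \<in> carrier G" "h k x = y" using exR[OF h(1), of x y] by blast
          have "h g y = h (g \<otimes>\<^bsub>G\<^esub> k) x"
            using hom_sym_grp_mult[OF homR[OF h(1)] g k(1)] k(2) by simp
          also have "\<dots> = h' (g \<otimes>\<^bsub>G\<^esub> k) x'" using g k(1) by (intro eq') simp
          also have "\<dots> = h' g (h' k x')" using hom_sym_grp_mult[OF homR[OF h(2)] g k(1)] by simp
          also have "h' k x' = y" using eq'[OF k(1)] k(2) by simp
          finally show "h g y = h' g y" .
        qed
      qed
      then show ?thesis using x uv by simp
    qed
    then show "((case u of (h, x) \<Rightarrow> \<lambda>g\<in>carrier G. h g x) = (case v of (h, x) \<Rightarrow> \<lambda>g\<in>carrier G. h g x)) = (u = v)"
      using uv by auto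
  next
    fix u assume "u \<in> ?R \<times> (UNIV :: 'a set)"
    then obtain h x where u: "u = (h, x)" and h: "h \<in> ?R" by blast
    have "bij_betw (\<lambda>g\<in>carrier G. h g x) (carrier G) UNIV"
    proof (rule bij_betwI')
      fix g k assume g: "g \<in> carrier G" "k \<in> carrier G"
      have "g = k" if "h g x = h k x" using exR[OF h, of x "h k x"] g that by blast
      then show "((\<lambda>g\<in>carrier G. h g x) g = (\<lambda>g\<in>carrier G. h g x) k) = (g = k)" using g by auto
    next
      fix y
      obtain g where "g \<in> carrier G" "h g x = y" using exR[OF h, of x y] by blast
      then show "\<exists>g\<in>carrier G. y = (\<lambda>g\<in>carrier G. h g x) g" by auto
    qed simp
    then show "(case u of (h, x) \<Rightarrow> \<lambda>g\<in>carrier G. h g x) \<in> ?B" by (simp add: u)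
  next
    fix b assume "b \<in> ?B"
    then have b: "b \<in> extensional (carrier G)" "bij_betw b (carrier G) UNIV" by (auto simp: PiE_iff)
    define \<beta> where "\<beta> = inv_into (carrier G) b"
    have \<beta>: "\<beta> y \<in> carrier G" "b (\<beta> y) = y" for y
      using b(2) by (auto simp: \<beta>_def bij_betw_def inv_into_into f_inv_into_f)
    have \<beta>b: "\<beta> (b g) = g" if "g \<in> carrier G" for g
      using b(2) that by (simp add: \<beta>_def bij_betw_def)
    \<comment> \<open>Left multiplication of \<open>G\<close>, transported along the bijection
      \<open>b\<close>; the base point will be the image of the identity.\<close>
    define h where "h = (\<lambda>g\<in>carrier G. \<lambda>y. b (g \<otimes>\<^bsub>G\<^esub> \<beta> y))"
    have mult: "h g (h k y) = h (g \<otimes>\<^bsub>G\<^esub> k) y" if "g \<in> carrier G" "k \<in> carrier G" for g k y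
      using that \<beta> by (simp add: h_def \<beta>b G.m_assoc)
    have one: "h \<one>\<^bsub>G\<^esub> y = y" for y using \<beta> by (simp add: h_def)
    have bij: "bij (h g)" if "g \<in> carrier G" for g
    proof (rule o_bij)
      show "h (inv\<^bsub>G\<^esub> g) \<circ> h g = id" "h g \<circ> h (inv\<^bsub>G\<^esub> g) = id"
        using that by (simp_all add: fun_eq_iff mult one)
    qed
    have "h \<in> hom G sym_grp"
    proof (rule homI)
      fix g k assume g: "g \<in> carrier G" "k \<in> carrier G"
      show "h g \<in> carrier sym_grp" using bij g by simp
      show "h (g \<otimes>\<^bsub>G\<^esub> k) = h g \<otimes>\<^bsub>sym_grp\<^esub> h k"
        using g by (simp add: mult_sym_grp bij fun_eq_iff mult)
    qed
    moreover have "\<exists>!g. g \<in> carrier G \<and> h g x = y" for x y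
    proof (rule ex1I)
      show "\<beta> y \<otimes>\<^bsub>G\<^esub> inv\<^bsub>G\<^esub> \<beta> x \<in> carrier G \<and> h (\<beta> y \<otimes>\<^bsub>G\<^esub> inv\<^bsub>G\<^esub> \<beta> x) x = y"
        using \<beta> by (simp add: h_def G.m_assoc)
      fix g assume g: "g \<in> carrier G \<and> h g x = y"
      then have "g \<in> carrier G" "h g x = y" by simp_all
      then have "b (g \<otimes>\<^bsub>G\<^esub> \<beta> x) = y" by (simp add: h_def)
      then have "g \<otimes>\<^bsub>G\<^esub> \<beta> x = \<beta> y"
        using \<beta>b[of "g \<otimes>\<^bsub>G\<^esub> \<beta> x"] \<open>g \<in> carrier G\<close> \<beta>(1)[of x] by simp
      then have "\<beta> y \<otimes>\<^bsub>G\<^esub> inv\<^bsub>G\<^esub> \<beta> x = g \<otimes>\<^bsub>G\<^esub> \<beta> x \<otimes>\<^bsub>G\<^esub> inv\<^bsub>G\<^esub> \<beta> x" by simp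
      also have "\<dots> = g" using \<open>g \<in> carrier G\<close> \<beta>(1)[of x] by (simp add: G.m_assoc)
      finally show "g = \<beta> y \<otimes>\<^bsub>G\<^esub> inv\<^bsub>G\<^esub> \<beta> x" by (rule sym)
    qed
    ultimately have h: "h \<in> ?R" by (simp add: regular_homs_def h_def)
    have "b = (\<lambda>g\<in>carrier G. h g (b \<one>\<^bsub>G\<^esub>))"
      by (rule extensionalityI[OF b(1)]) (simp_all add: h_def \<beta>b)
    then have "b = (case (h, b \<one>\<^bsub>G\<^esub>) of (h, x) \<Rightarrow> \<lambda>g\<in>carrier G. h g x)" by simp
    moreover have "(h, b \<one>\<^bsub>G\<^esub>) \<in> ?R \<times> UNIV" using h by simp
    ultimately show "\<exists>u\<in>?R \<times> UNIV. b = (case u of (h, x) \<Rightarrow> \<lambda>g\<in>carrier G. h g x)" by (rule bexI)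
  qed
  from bij_betw_same_card[OF this] show ?thesis
    using card_bijections[OF finG finite, of "UNIV :: 'a set"] card by (simp add: card_cartesian_product mult.commute)
qed

section \<open>Simply transitive subgroups isomorphic to a given group\<close>

definition regular_copies :: "('g, 'm) monoid_scheme \<Rightarrow> ('a \<Rightarrow> 'a) set set" where
  "regular_copies G = {H. subgroup H sym_grp \<and> simply_transitive H \<and> sym_grp\<lparr>carrier := H\<rparr> \<cong> G}"

text \<open>In a regular action, elements that agree at one point are equal, so \<open>h\<close> is
  injective and an isomorphism onto its image. That image is the copy to which \<open>h\<close>
  belongs.\<close>

lemma regular_homs_eq_isos:
  assumes G: "group G"
  shows "regular_homs G = (\<Union>H\<in>regular_copies G. isos G (sym_grp\<lparr>carrier := H\<rparr>))"
proof (intro equalityI subsetI)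
  fix h assume "h \<in> regular_homs G"
  then have h: "h \<in> hom G sym_grp" "h \<in> extensional (carrier G)"
    "\<And>x y. \<exists>!g. g \<in> carrier G \<and> h g x = y" by (auto simp: regular_homs_def)
  define H where "H = h ` carrier G"
  interpret group_hom G sym_grp h
    using G group_BijGroup h(1) by (simp add: group_hom_def group_hom_axioms_def)
  have sub: "subgroup H sym_grp" unfolding H_def by (rule img_is_subgroup)
  have inj: "inj_on h (carrier G)"
  proof (rule inj_onI)
    fix g k assume "g \<in> carrier G" "k \<in> carrier G" "h g = h k"
    \<comment> \<open>\<open>undefined\<close> merely names some point.\<close>
    then show "g = k" using h(3)[of undefined "h k undefined"] by metis
  qed
  have "simply_transitive H"
    unfolding simply_transitive_def H_def
  proof (intro allI)
    fix x y
    obtain g where g: "g \<in> carrier G" "h g x = y" "\<And>k. k \<in> carrier G \<Longrightarrow> h k x = y \<Longrightarrow> k = g"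
      using h(3)[of x y] by blast
    show "\<exists>!f. f \<in> h ` carrier G \<and> f x = y"
    proof (rule ex1I)
      show "h g \<in> h ` carrier G \<and> h g x = y" using g(1,2) by simp
      fix f assume f: "f \<in> h ` carrier G \<and> f x = y"
      then obtain k where k: "k \<in> carrier G" "f = h k" by blast
      then show "f = h g" using g(3)[of k] f by simp
    qed
  qed
  moreover have iso: "h \<in> iso G (sym_grp\<lparr>carrier := H\<rparr>)"
    using h(1) inj by (auto simp: iso_def hom_def bij_betw_def H_def)
  then have "sym_grp\<lparr>carrier := H\<rparr> \<cong> G"
    using group.iso_sym[OF G] by (auto simp: is_iso_def)
  ultimately have "H \<in> regular_copies G" using sub by (simp add: regular_copies_def)
  then show "h \<in> (\<Union>H\<in>regular_copies G. isos G (sym_grp\<lparr>carrier := H\<rparr>))"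
    using iso h(2) by (auto simp: isos_def)
next
  fix h assume "h \<in> (\<Union>H\<in>regular_copies G. isos G (sym_grp\<lparr>carrier := H\<rparr>))"
  then obtain H where H: "subgroup H sym_grp" "simply_transitive H"
    and hom: "h \<in> hom G (sym_grp\<lparr>carrier := H\<rparr>)" and bij: "bij_betw h (carrier G) H"
    and ext: "h \<in> extensional (carrier G)"
    by (auto simp: regular_copies_def isos_def iso_def)
  have "h \<in> hom G sym_grp" using hom subgroup.subset[OF H(1)] by (auto simp: hom_def)
  moreover have "\<exists>!g. g \<in> carrier G \<and> h g x = y" for x y
  proof -
    obtain f where f: "f \<in> H" "f x = y" "\<And>f'. f' \<in> H \<Longrightarrow> f' x = y \<Longrightarrow> f' = f"
      using H(2) unfolding simply_transitive_def by metis
    have "f \<in> h ` carrier G" using f(1) bij by (simp add: bij_betw_def)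
    then obtain g where g: "g \<in> carrier G" "h g = f" by auto
    show ?thesis
    proof (rule ex1I)
      show "g \<in> carrier G \<and> h g x = y" using f(2) g by simp
      fix k assume k: "k \<in> carrier G \<and> h k x = y"
      have "h k \<in> H" using k bij_betwE[OF bij] by blast
      then have "h k = h g" using f(3)[of "h k"] g(2) k by simp
      then show "k = g" using k g(1) by (intro inj_onD[OF bij_betw_imp_inj_on[OF bij]]) simp_all
    qed
  qed
  ultimately show "h \<in> regular_homs G" using ext by (simp add: regular_homs_def)
qed

text \<open>Double counting of \<open>regular_homs G\<close>: by image there are
  \<open>card ?C * ?A\<close> of them, as each copy receives \<open>?A\<close> isomorphisms;
  together with a base point they number \<open>fact (p ^ (m + \<delta>))\<close>.\<close>

lemma card_regular_copies:
  fixes G :: "('g, 'm) monoid_scheme"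
  assumes p: "prime p" and \<delta>: "\<delta> \<in> {1, 2}" and G: "comm_group G"
    and a: "indep G (digit_radix p \<delta>) (Suc m) a"
    and card: "card (carrier G) = p ^ (m + \<delta>)" "CARD('a) = p ^ (m + \<delta>)"
  shows "card (regular_copies G :: ('a::finite \<Rightarrow> 'a) set set) *
    ((p ^ (m + \<delta>) - p ^ ((\<delta> - 1) * (m + 1))) * (\<Prod>i = 1..m. p ^ (m + 1) - p ^ i)) = fact (p ^ (m + \<delta>) - 1)"
    (is "card ?C * ?A = _")
proof -
  interpret G: comm_group G by fact
  have p0: "p > 0" using p by (rule prime_gt_0_nat)
  have prod: "(\<Prod>i<Suc m. digit_radix p \<delta> i) = p ^ (m + \<delta>)"
    unfolding prod.lessThan_Suc_shift by (simp add: digit_radix_def power_add)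
  have card_isos: "finite (isos G (sym_grp\<lparr>carrier := H\<rparr>)) \<and> card (isos G (sym_grp\<lparr>carrier := H\<rparr>)) = ?A"
    if H: "H \<in> ?C" for H
  proof -
    let ?H = "sym_grp\<lparr>carrier := H\<rparr>"
    have sub: "subgroup H sym_grp" and iso: "?H \<cong> G" and tr: "simply_transitive H"
      using H by (simp_all add: regular_copies_def)
    have grp: "group ?H" by (rule subgroup.subgroup_is_group[OF sub group_BijGroup])
    have GH: "G \<cong> ?H" using iso by (rule group.iso_sym[OF grp])
    have comm: "comm_group ?H" using GH grp by (intro G.iso_imp_comm_group) (simp_all add: group.is_monoid)
    have cH: "card (carrier ?H) = p ^ (m + \<delta>)" using card_simply_transitive[OF tr] card(2) by simp
    have bij: "bij_betw (\<lambda>h. \<lambda>i\<in>{..<Suc m}. h (a i)) (isos G ?H) (indep_tuples ?H (digit_radix p \<delta>) (Suc m))"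
      using isos_indep_tuples[OF G comm a] p0 prod card(1) cH by (simp add: digit_radix_pos)
    \<comment> \<open>Transporting \<open>a\<close> along an isomorphism provides the independent
      tuple in \<open>?H\<close> that the count of tuples there starts from.\<close>
    obtain h where h: "h \<in> iso G ?H" using GH by (auto simp: is_iso_def)
    then have "restrict h (carrier G) \<in> isos G ?H"
      by (auto simp: isos_def iso_def hom_def bij_betw_def inj_on_restrict_eq)
    then have "(\<lambda>i\<in>{..<Suc m}. restrict h (carrier G) (a i)) \<in> indep_tuples ?H (digit_radix p \<delta>) (Suc m)"
      using bij_betwE[OF bij] by blast
    then obtain b where b: "indep ?H (digit_radix p \<delta>) (Suc m) b" by (auto simp: indep_tuples_def)
    have "card (indep_tuples ?H (digit_radix p \<delta>) (Suc m)) = ?A"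
      by (rule comm_group.card_indep_tuples[OF comm p \<delta> _ b cH]) (auto simp: digit_radix_def)
    moreover have "finite (isos G ?H)"
    proof -
      have "finite (\<Pi>\<^sub>E i\<in>{..<Suc m}. carrier ?H)" by (intro finite_PiE) simp_all
      then have "finite (indep_tuples ?H (digit_radix p \<delta>) (Suc m))"
        by (rule rev_finite_subset) (auto simp: indep_tuples_def)
      then show ?thesis using bij_betw_finite[OF bij] by simp
    qed
    ultimately show ?thesis using bij_betw_same_card[OF bij] by simp
  qed
  have "card (regular_homs G :: ('g \<Rightarrow> 'a \<Rightarrow> 'a) set) = (\<Sum>H\<in>?C. card (isos G (sym_grp\<lparr>carrier := H\<rparr>)))"
    unfolding regular_homs_eq_isos[OF G.is_group]
  proof (rule card_UN_disjoint)
    \<comment> \<open>An isomorphism onto \<open>H\<close> has image \<open>H\<close>, hence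
      determines it.\<close>
    show "\<forall>H\<in>?C. \<forall>H'\<in>?C. H \<noteq> H' \<longrightarrow>
        isos G (sym_grp\<lparr>carrier := H\<rparr>) \<inter> isos G (sym_grp\<lparr>carrier := H'\<rparr>) = {}"
      by (auto simp: isos_def iso_def bij_betw_def)
  qed (use card_isos in simp_all)
  then have "card (regular_homs G :: ('g \<Rightarrow> 'a \<Rightarrow> 'a) set) = card ?C * ?A" using card_isos by simp
  then have "p ^ (m + \<delta>) * (card ?C * ?A) = fact (p ^ (m + \<delta>))"
    using card_regular_homs[OF G.is_group, where 'a = 'a] card by simp
  also have "\<dots> = p ^ (m + \<delta>) * fact (p ^ (m + \<delta>) - 1)"
    using p0 by (subst fact_reduce) simp_all
  finally show ?thesis using p0 by simp
qed

section \<open>The number of permutation group polynomials of the given form\<close>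

theorem theorem4p4:
  fixes c :: "nat \<Rightarrow> 'a::{finite,field}"
    and p n \<delta> :: nat
    and f :: "'a poly poly"
  assumes "\<delta> \<in> {1, 2}"
    and "prime p"
    and "n \<ge> 2"
    and "CARD('a) = p ^ n"
    and "bij_betw c {..<p ^ n} UNIV"
    and "perm_group_poly c f"
    and "assoc_set c f = G_set p n \<delta> c"
  shows "real (num_same_form c f) =
    fact (p ^ n) * fact (p ^ n - 1) /
    ((real p ^ n - real p ^ ((\<delta> - 1) * (n - \<delta> + 1))) *
     (\<Prod>i = 1..n - \<delta>. real p ^ (n - \<delta> + 1) - real p ^ i))"
proof -
  define m where "m = n - \<delta>"
  have \<delta>: "0 < \<delta>" "\<delta> \<le> n" and n: "n = m + \<delta>" using assms(1,3) by (auto simp: m_def)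
  have p: "p > 0" using assms(2) by (rule prime_gt_0_nat)
  define G where "G = sym_grp\<lparr>carrier := G_set p n \<delta> c\<rparr>"
  define C where "C = (regular_copies G :: ('a \<Rightarrow> 'a) set set)"
  define A where "A = (p ^ n - p ^ ((\<delta> - 1) * (m + 1))) * (\<Prod>i = 1..m. p ^ (m + 1) - p ^ i)"
  have c: "bij_betw c {..<CARD('a)} UNIV" using assms(4,5) by simp
  have "simply_transitive (G_set p n \<delta> c)"
    using simply_transitive_assoc_set[OF c, of f] assms(6,7) by (simp add: perm_group_poly_def)
  \<comment> \<open>The order of \<open>G\<close> is obtained from \<open>f\<close>: as its
    associated set, \<open>G\<close> is simply transitive.\<close>
  then have cG: "card (G_set p n \<delta> c) = p ^ n" using card_simply_transitive assms(4) by metis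
  have "card C * A = fact (p ^ n - 1)"
    unfolding C_def A_def n
  proof (rule card_regular_copies)
    show "comm_group G" unfolding G_def by (rule comm_group_G_set[OF p \<delta> assms(5)])
    show "indep G (digit_radix p \<delta>) (Suc m) (gen p n \<delta> c)"
      unfolding G_def m_def by (rule indep_gen[OF p \<delta> assms(5) cG])
  qed (use assms cG n in \<open>simp_all add: G_def\<close>)
  then have CA: "real (card C) * real A = fact (p ^ n - 1)"
    by (metis of_nat_fact of_nat_mult)
  have fibre: "card {g. local_perm_poly g \<and> assoc_set c g = H} = fact (p ^ n)" if "H \<in> C" for H
  proof -
    have H: "simply_transitive H" "subgroup H sym_grp"
      using that by (simp_all add: C_def regular_copies_def)
    then show ?thesis
      using card_local_perm_poly_assoc_set[OF c H(1)] subgroup.mem_carrier[OF H(2)] assms(4) by simp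
  qed
  \<comment> \<open>Sorting by associated group; simple transitivity of that group is
    automatic.\<close>
  have "{g. perm_group_poly c g \<and> same_form c g f} = (\<Union>H\<in>C. {g. local_perm_poly g \<and> assoc_set c g = H})"
    using simply_transitive_assoc_set[OF c]
    by (auto simp: C_def G_def regular_copies_def perm_group_poly_def same_form_def assms(7))
  then have "num_same_form c f = card (\<Union>H\<in>C. {g. local_perm_poly g \<and> assoc_set c g = H})"
    by (simp add: num_same_form_def)
  also have "\<dots> = (\<Sum>H\<in>C. card {g. local_perm_poly g \<and> assoc_set c g = H})"
  proof (rule card_UN_disjoint)
    show "\<forall>H\<in>C. finite {g. local_perm_poly g \<and> assoc_set c g = H}"
      using fibre by (intro ballI card_ge_0_finite) simp
  qed auto
  also have "\<dots> = card C * fact (p ^ n)" using fibre by simp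
  finally have N: "real (num_same_form c f) = real (card C) * fact (p ^ n)" by simp
  \<comment> \<open>\<open>A\<close> uses truncated subtraction; the real formula agrees because
    each subtracted power has an exponent no larger than that of the first.\<close>
  have denominator: "real A = (real p ^ n - real p ^ ((\<delta> - 1) * (n - \<delta> + 1))) *
     (\<Prod>i = 1..n - \<delta>. real p ^ (n - \<delta> + 1) - real p ^ i)"
  proof -
    have "(\<delta> - 1) * (m + 1) \<le> n" using assms(1) n by auto
    then have "p ^ ((\<delta> - 1) * (m + 1)) \<le> p ^ n" using p by (intro power_increasing) simp_all
    moreover have "p ^ i \<le> p ^ (m + 1)" if "i \<in> {1..m}" for i using p that by (intro power_increasing) simp_all
    ultimately show ?thesis unfolding A_def m_def[symmetric] by (simp add: of_nat_diff)
  qed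
  \<comment> \<open>\<open>A\<close> divides a factorial, so division by it is legitimate.\<close>
  have "real A \<noteq> 0" using CA by (metis fact_nonzero mult_zero_right)
  then show ?thesis unfolding denominator[symmetric] N CA[symmetric] by simp
qed

end
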